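(* Let $q$ be a prime power, let $M\ge 1$, $\ell \ge 1$ and $1 \le k < n$ be integers. Let $n = n_1 + n_2 + \cdots + n_\ell$ with integers $n_i \ge 1$ be a code-length partition, defining the associated sum-rank metric on $\mathbb{F}_{q^M}^n$, and let $k = k_1 + k_2 + \cdots + k_\ell$ be a partition with integers $0 \le k_i \le n_i$ for $i = 1,\ldots,\ell$. Let $$G = [J_1, P_1, J_2, P_2, \ldots, J_\ell, P_\ell] \in \mathbb{F}_{q^M}^{k\times n}$$ be a systematic encoder of the code $\mathcal{C} = \{uG : u \in \mathbb{F}_{q^M}^k\} \subseteq \mathbb{F}_{q^M}^n$, where, for $i=1,\ldots,\ell$, $P_i \in \mathbb{F}_{q^M}^{k\times(n_i-k_i)}$ is arbitrary and $J_i \in \mathbb{F}_{q^M}^{k\times k_i}$ is zero everywhere except in the $i$-th block of $k_i$ rows, where it is the identity matrix of size $k_i$ (so that $[J_1, J_2, \ldots, J_\ell] = I_k$). Put $P = [P_1, P_2, \ldots, P_\ell] \in \mathbb{F}_{q^M}^{k\times(n-k)}$. Then the following are equivalent. 1. $\mathcal{C}$ is MSRD (with respect to the sum-rank metric given by the partition $n = n_1 + \cdots + n_\ell$). 2. The matrix $$\mathrm{diag}(B_1, B_2, \ldots, B_\ell)\; P\; \mathrm{diag}(\widetilde{A}_1, \widetilde{A}_2, \ldots, \widetilde{A}_\ell) + \mathrm{diag}(C_1, C_2, \ldots, C_\ell) \in \mathbb{F}_{q^M}^{k\times(n-k)}$$ is full superregular for all matrices $C_i \in \mathbb{F}_q^{k_i\times(n_i-k_i)}$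 and all nonsingular upper triangular matrices $B_i \in \mathbb{F}_q^{k_i\times k_i}$ and $\widetilde{A}_i \in \mathbb{F}_q^{(n_i-k_i)\times(n_i-k_i)}$, $i = 1,2,\ldots,\ell$.
   Context: For $v \in \mathbb{F}_{q^M}^{r}$, $\mathrm{rank}(v)$ denotes the rank over $\mathbb{F}_q$ of the $M\times r$ matrix over $\mathbb{F}_q$ obtained by expanding each coordinate of $v$ as a column with respect to a fixed basis of $\mathbb{F}_{q^M}$ over $\mathbb{F}_q$ (equivalently, the $\mathbb{F}_q$-dimension of the $\mathbb{F}_q$-span of the coordinates of $v$). Given $n = n_1 + \cdots + n_\ell$, write $v \in \mathbb{F}_{q^M}^n$ as $v = (v_1, \ldots, v_\ell)$ with $v_i \in \mathbb{F}_{q^M}^{n_i}$. The sum-rank metric is $d_{SR}(v,w) = \sum_{i=1}^\ell \mathrm{rank}(v_i - w_i)$, and the minimum sum-rank distance of an $\mathbb{F}_{q^M}$-linear code $\mathcal{C}\subseteq\mathbb{F}_{q^M}^n$ is $d_{SR}(\mathcal{C}) = \min\{d_{SR}(v,0) : v \in \mathcal{C},\ v \ne 0\}$. A $k$-dimensional $\mathbb{F}_{q^M}$-linear code satisfies $d_{SR}(\mathcal{C}) \le n-k+1$, and it is called MSRD (maximum sum-rank distance) if $d_{SR}(\mathcal{C}) = n-k+1$. A matrix over $\mathbb{F}_{q^M}$ is called full superregular if all its minors, of every size, are nonzero. $\mathrm{diag}(X_1,\ldots,X_\ell)$ denotes the block-diagonal matrix with (possibly rectangular) diagonal blocks $X_1,\ldots,X_\ell$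 and zeros elsewhere. Blocks with zero rows or zero columns are allowed with the usual convention: if $k_i = 0$, then $J_i$ and $B_i$ are absent and $C_i$ has no rows (but still accounts for $n_i$ columns of the block-diagonal matrix); if $k_i = n_i$, then $P_i$ and $\widetilde{A}_i$ are absent and $C_i$ has no columns (but still accounts for $k_i$ rows). *)

theory Defs
  imports
    "Jordan_Normal_Form.DL_Rank"
    "Jordan_Normal_Form.DL_Submatrix"
    "HOL-Library.Cardinality"
    "HOL-Number_Theory.Prime_Powers"
begin

text \<open>
  A field extension is given by a field homomorphism \<open>emb :: 'f \<Rightarrow> 'a\<close> from the small field
  (of cardinality \<open>q\<close>) into the large one (of cardinality \<open>q ^ M\<close>).
  A partition \<open>n = n\<^sub>1 + \<dots> + n\<^sub>\<ell>\<close> is given by the number \<open>l\<close> of parts and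
  a function \<open>ns\<close>, of which only the values \<open>ns i\<close> for \<open>i < l\<close> matter;
  all indices start at 0.
\<close>

definition ext_scale :: "('f::field \<Rightarrow> 'a::field) \<Rightarrow> 'f \<Rightarrow> 'a \<Rightarrow> 'a" where
  "ext_scale emb c x = emb c * x"

definition ext_basis :: "('f::field \<Rightarrow> 'a::field) \<Rightarrow> 'a list \<Rightarrow> bool" where
  "ext_basis emb bs \<longleftrightarrow> distinct bs \<and>
     \<not> Modules.module.dependent (ext_scale emb) (set bs) \<and>
     Modules.module.span (ext_scale emb) (set bs) = UNIV"

text \<open>Column \<open>j\<close> consists of the coordinates of the entry \<open>v $ j\<close> with respect to \<open>bs\<close>.\<close>

definition expand_mat :: "('f::field \<Rightarrow> 'a::field) \<Rightarrow> 'a list \<Rightarrow> 'a vec \<Rightarrow> 'f mat" where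
  "expand_mat emb bs v = mat (length bs) (dim_vec v)
     (\<lambda>(i, j). Modules.module.representation (ext_scale emb) (set bs) (v $ j) (bs ! i))"

definition rank_weight :: "('f::field \<Rightarrow> 'a::field) \<Rightarrow> 'a list \<Rightarrow> 'a vec \<Rightarrow> nat" where
  "rank_weight emb bs v = vec_space.rank (length bs) (expand_mat emb bs v)"

definition part_offset :: "(nat \<Rightarrow> nat) \<Rightarrow> nat \<Rightarrow> nat" where
  "part_offset ns i = (\<Sum>j<i. ns j)"

definition vec_part :: "(nat \<Rightarrow> nat) \<Rightarrow> 'a vec \<Rightarrow> nat \<Rightarrow> 'a vec" where
  "vec_part ns v i = vec (ns i) (\<lambda>j. v $ (part_offset ns i + j))"

definition sum_rank_dist ::
  "('f::field \<Rightarrow> 'a::field) \<Rightarrow> 'a list \<Rightarrow> nat \<Rightarrow> (nat \<Rightarrow> nat) \<Rightarrow> 'a vec \<Rightarrow> 'a vec \<Rightarrow> nat" where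
  "sum_rank_dist emb bs l ns v w =
     (\<Sum>i<l. rank_weight emb bs (vec_part ns v i - vec_part ns w i))"

definition linear_code :: "nat \<Rightarrow> 'a::field vec set \<Rightarrow> bool" where
  "linear_code n C \<longleftrightarrow> VectorSpace.subspace class_ring C (module_vec TYPE('a) n)"

definition code_dim :: "nat \<Rightarrow> 'a::field vec set \<Rightarrow> nat" where
  "code_dim n C = vectorspace.dim class_ring ((module_vec TYPE('a) n)\<lparr>carrier := C\<rparr>)"

text \<open>
  Over a finite field the set under the minimum is finite; it is nonempty unless the code is zero.
\<close>

definition min_sum_rank_dist ::
  "('f::field \<Rightarrow> 'a::field) \<Rightarrow> 'a list \<Rightarrow> nat \<Rightarrow> (nat \<Rightarrow> nat) \<Rightarrow> 'a vec set \<Rightarrow> nat" where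
  "min_sum_rank_dist emb bs l ns C =
     (let n = \<Sum>i<l. ns i in
       Min {sum_rank_dist emb bs l ns v (0\<^sub>v n) | v. v \<in> C \<and> v \<noteq> 0\<^sub>v n})"

definition MSRD ::
  "('f::field \<Rightarrow> 'a::field) \<Rightarrow> 'a list \<Rightarrow> nat \<Rightarrow> (nat \<Rightarrow> nat) \<Rightarrow> 'a vec set \<Rightarrow> bool" where
  "MSRD emb bs l ns C \<longleftrightarrow>
     (let n = \<Sum>i<l. ns i in
       linear_code n C \<and> min_sum_rank_dist emb bs l ns C = n - code_dim n C + 1)"

definition full_superregular :: "'a::comm_ring_1 mat \<Rightarrow> bool" where
  "full_superregular X \<longleftrightarrow>
     (\<forall>I J. I \<subseteq> {..<dim_row X} \<and> J \<subseteq> {..<dim_col X} \<and> I \<noteq> {} \<and> card I = card J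
        \<longrightarrow> det (submatrix X I J) \<noteq> 0)"

text \<open>
  Horizontal concatenation of matrices with \<open>k\<close> rows; blocks without columns contribute nothing.
\<close>

definition hconcat_mat :: "nat \<Rightarrow> 'a mat list \<Rightarrow> 'a mat" where
  "hconcat_mat k Xs = mat_of_cols k (concat (map cols Xs))"

definition J_mat :: "nat \<Rightarrow> (nat \<Rightarrow> nat) \<Rightarrow> nat \<Rightarrow> 'a::zero_neq_one mat" where
  "J_mat k ks i = mat k (ks i) (\<lambda>(r, c). if r = part_offset ks i + c then 1 else 0)"

definition systematic_encoder ::
  "nat \<Rightarrow> nat \<Rightarrow> (nat \<Rightarrow> nat) \<Rightarrow> (nat \<Rightarrow> 'a mat) \<Rightarrow> 'a::zero_neq_one mat" where
  "systematic_encoder k l ks P = hconcat_mat k (concat (map (\<lambda>i. [J_mat k ks i, P i]) [0..<l]))"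

text \<open>The row vector \<open>u G\<close> is the vector \<open>G\<^sup>T u\<close>.\<close>

definition code_of :: "'a::field mat \<Rightarrow> 'a vec set" where
  "code_of G = {transpose_mat G *\<^sub>v u | u. u \<in> carrier_vec (dim_row G)}"

definition block_diag :: "nat \<Rightarrow> (nat \<Rightarrow> 'a::zero mat) \<Rightarrow> 'a mat" where
  "block_diag l X = diag_block_mat (map X [0..<l])"

end

theory Submission
  imports Defs
begin

text \<open>
  A codeword \<open>u G\<close> has the parts \<open>(u\<^sub>i, u P\<^sub>i)\<close>, so the code is MSRD iff the \<open>F\<^sub>q\<close>-ranks of these
  parts add up to more than \<open>n - k\<close> for all \<open>u \<noteq> 0\<close>. On the other hand, a \<open>k \<times> (n - k)\<close> matrix \<open>X\<close>
  is full superregular iff the Hamming weights of \<open>u\<close> and \<open>u X\<close> add up to more than \<open>n - k\<close>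
  for all \<open>u \<noteq> 0\<close>.

  For \<open>X = B P A + C\<close> and \<open>w = u B\<close>, the entries of \<open>(w\<^sub>i, w P\<^sub>i)\<close> are \<open>F\<^sub>q\<close>-combinations of those of
  \<open>u\<^sub>i\<close> and \<open>(u X)\<^sub>i\<close>, so small Hamming weights force small ranks. Conversely, in \<open>(u\<^sub>i, u P\<^sub>i)\<close> replace
  every entry that lies in the \<open>F\<^sub>q\<close>-span of the preceding ones by 0: the number of remaining nonzero
  entries is at most the rank, and the elimination is an upper unitriangular column operation, that is,
  it provides \<open>B\<^sub>i\<close>, \<open>A\<^sub>i\<close> and \<open>C\<^sub>i\<close>.
\<close>

section \<open>Vectors split into parts\<close>

lemma part_offset_0 [simp]: "part_offset ns 0 = 0"
  and part_offset_Suc: "part_offset ns (Suc i) = part_offset ns i + ns i"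
  by (simp_all add: part_offset_def)

lemma part_offset_add_le:
  assumes "i < l"
  shows "part_offset ns i + ns i \<le> part_offset ns l"
proof -
  have "sum ns {..<Suc i} \<le> sum ns {..<l}"
    using assms by (intro sum_mono2) auto
  then show ?thesis by (simp add: part_offset_def)
qed

lemma part_offset_add_less:
  assumes "i < l" "a < ns i"
  shows "part_offset ns i + a < part_offset ns l"
  using part_offset_add_le[OF assms(1), of ns] assms(2) by linarith

lemma part_offset_diff:
  assumes "\<And>i. i < l \<Longrightarrow> ks i \<le> ns i"
  shows "part_offset (\<lambda>i. ns i - ks i) l = part_offset ns l - part_offset ks l"
  unfolding part_offset_def by (rule sum_subtractf_nat) (simp add: assms)

lemma part_offset_decompose:
  assumes "j < part_offset ns l"
  obtains i a where "i < l" "a < ns i" "j = part_offset ns i + a"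
proof -
  have "\<exists>i<l. \<exists>a<ns i. j = part_offset ns i + a"
    using assms
  proof (induction l)
    case (Suc l)
    show ?case
    proof (cases "j < part_offset ns l")
      case True
      with Suc.IH show ?thesis using less_SucI by blast
    next
      case False
      then show ?thesis
        using Suc.prems
        by (intro exI[of _ l] conjI exI[of _ "j - part_offset ns l"]) (auto simp: part_offset_Suc)
    qed
  qed simp
  then show ?thesis using that by blast
qed

lemma sum_lessThan_add:
  fixes f :: "nat \<Rightarrow> 'b::comm_monoid_add"
  shows "(\<Sum>x<m + n. f x) = (\<Sum>x<m. f x) + (\<Sum>a<n. f (m + a))"
  by (induction n) (simp_all add: add.assoc)

lemma sum_parts:
  fixes f :: "nat \<Rightarrow> 'b::comm_monoid_add"
  shows "(\<Sum>x<part_offset ns l. f x) = (\<Sum>i<l. \<Sum>a<ns i. f (part_offset ns i + a))"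
  by (induction l) (simp_all add: part_offset_Suc sum_lessThan_add)

lemma nth_concat_parts:
  assumes "\<And>i. i < l \<Longrightarrow> length (f i) = ns i" and "i < l" "a < ns i"
  shows "concat (map f [0..<l]) ! (part_offset ns i + a) = f i ! a"
  using assms
proof (induction l)
  case (Suc l)
  have len: "length (concat (map f [0..<l])) = part_offset ns l"
    using Suc.prems(1) by (simp add: length_concat part_offset_def o_def
        interv_sum_list_conv_sum_set_nat atLeast0LessThan)
  show ?case
  proof (cases "i < l")
    case True
    then show ?thesis
      using Suc part_offset_add_less[OF True, of a ns] by (simp add: nth_append len)
  next
    case False
    with Suc.prems have "i = l" by simp
    then show ?thesis by (simp add: nth_append len)
  qed
qed simp

lemma dim_vec_part [simp]: "dim_vec (vec_part ns v i) = ns i"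
  and vec_part_carrier [simp]: "vec_part ns v i \<in> carrier_vec (ns i)"
  and vec_part_index [simp]: "a < ns i \<Longrightarrow> vec_part ns v i $ a = v $ (part_offset ns i + a)"
  by (simp_all add: vec_part_def)

lemma vec_parts_eqI:
  assumes "v \<in> carrier_vec (part_offset ns l)" "w \<in> carrier_vec (part_offset ns l)"
    and "\<And>i. i < l \<Longrightarrow> vec_part ns v i = vec_part ns w i"
  shows "v = w"
proof (rule eq_vecI)
  fix j assume "j < dim_vec w"
  then obtain i a where "i < l" "a < ns i" "j = part_offset ns i + a"
    using assms(2) by (auto elim: part_offset_decompose)
  then show "v $ j = w $ j"
    using assms(3)[of i] by (metis vec_part_index)
qed (use assms in auto)

text \<open>Concatenating the entry lists realises any prescribed family of parts. This later glues
  the vectors that the elimination yields block by block into a single message.\<close>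

lemma vec_parts_obtain:
  assumes "\<And>i. i < l \<Longrightarrow> f i \<in> carrier_vec (ns i)"
  obtains v where "v \<in> carrier_vec (part_offset ns l)" "\<And>i. i < l \<Longrightarrow> vec_part ns v i = f i"
proof
  let ?v = "vec_of_list (concat (map (\<lambda>i. list_of_vec (f i)) [0..<l]))"
  show "?v \<in> carrier_vec (part_offset ns l)"
    unfolding carrier_vec_def part_offset_def
    by (simp add: length_concat o_def interv_sum_list_conv_sum_set_nat atLeast0LessThan
      carrier_vecD[OF assms])
  show "vec_part ns ?v i = f i" if "i < l" for i
    using nth_concat_parts[of l "\<lambda>i. list_of_vec (f i)" ns i, OF _ that] carrier_vecD[OF assms]
      carrier_vecD[OF assms[OF that]]
    by (intro eq_vecI) (simp_all add: vec_of_list_index list_of_vec_index)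
qed

lemma vec_part_0: "i < l \<Longrightarrow> vec_part ns (0\<^sub>v (part_offset ns l)) i = 0\<^sub>v (ns i)"
  by (intro eq_vecI) (auto simp: part_offset_add_less)

lemma vec_parts_eq_0:
  assumes "v \<in> carrier_vec (part_offset ns l)" "\<And>i. i < l \<Longrightarrow> vec_part ns v i = 0\<^sub>v (ns i)"
  shows "v = 0\<^sub>v (part_offset ns l)"
  by (rule vec_parts_eqI[OF assms(1)]) (simp_all add: assms(2) vec_part_0)

lemma vec_part_add:
  "i < l \<Longrightarrow> dim_vec w = part_offset ns l \<Longrightarrow>
    vec_part ns (v + w) i = vec_part ns v i + vec_part ns w i"
  by (intro eq_vecI) (auto simp: part_offset_add_less)

section \<open>Hamming weight and its additivity\<close>

definition hamming_weight :: "'a::zero vec \<Rightarrow> nat" where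
  "hamming_weight v = card {j. j < dim_vec v \<and> v $ j \<noteq> 0}"

lemma hamming_weight_eq_sum:
  "hamming_weight v = (\<Sum>j<dim_vec v. if v $ j \<noteq> 0 then 1 else 0)"
  by (simp add: hamming_weight_def sum.If_cases Int_def lessThan_def conj_commute)

lemma hamming_weight_parts:
  assumes "v \<in> carrier_vec (part_offset ns l)"
  shows "hamming_weight v = (\<Sum>i<l. hamming_weight (vec_part ns v i))"
  using assms by (simp add: hamming_weight_eq_sum sum_parts)

lemma hamming_weight_append:
  "hamming_weight (v @\<^sub>v w) = hamming_weight v + hamming_weight w"
  by (simp add: hamming_weight_eq_sum sum_lessThan_add)

lemma hamming_weight_le_dim: "hamming_weight v \<le> dim_vec v"
proof -
  have "hamming_weight v \<le> card {..<dim_vec v}"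
    unfolding hamming_weight_def by (intro card_mono) auto
  then show ?thesis by simp
qed

lemma hamming_weight_unit_vec_le: "hamming_weight (unit_vec k i) \<le> 1"
proof -
  have "hamming_weight (unit_vec k i :: 'a vec) \<le> card {i}"
    unfolding hamming_weight_def by (intro card_mono) (auto simp: unit_vec_def split: if_splits)
  then show ?thesis by simp
qed

section \<open>Block matrices and systematic encoders\<close>

lemma block_diag_Suc:
  "block_diag (Suc l) X = four_block_mat (block_diag l X)
     (0\<^sub>m (dim_row (block_diag l X)) (dim_col (X l)))
     (0\<^sub>m (dim_row (X l)) (dim_col (block_diag l X))) (X l)"
  by (simp add: block_diag_def diag_block_mat_last Let_def)

lemma block_diag_carrier:
  assumes "\<And>i. i < l \<Longrightarrow> X i \<in> carrier_mat (rs i) (cs i)"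
  shows "block_diag l X \<in> carrier_mat (part_offset rs l) (part_offset cs l)"
  using assms
proof (induction l)
  case (Suc l)
  then have "block_diag l X \<in> carrier_mat (part_offset rs l) (part_offset cs l)"
    "X l \<in> carrier_mat (rs l) (cs l)" by simp_all
  then show ?case
    by (simp add: block_diag_Suc part_offset_Suc)
qed (simp add: block_diag_def)

lemma block_diag_index:
  assumes "\<And>i. i < l \<Longrightarrow> X i \<in> carrier_mat (rs i) (cs i)"
    and "i < l" "j < l" "a < rs i" "b < cs j"
  shows "block_diag l X $$ (part_offset rs i + a, part_offset cs j + b)
    = (if i = j then X i $$ (a, b) else 0)"
  using assms
proof (induction l)
  case (Suc l)
  have [simp]: "dim_row (block_diag l X) = part_offset rs l" "dim_col (block_diag l X) = part_offset cs l"
    "dim_row (X l) = rs l" "dim_col (X l) = cs l"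
    using block_diag_carrier[of l X rs cs] Suc.prems(1) by auto
  have r: "part_offset rs i + a < part_offset rs l" if "i < l"
    using part_offset_add_less[where ns = rs, OF that Suc.prems(4)] .
  have c: "part_offset cs j + b < part_offset cs l" if "j < l"
    using part_offset_add_less[where ns = cs, OF that Suc.prems(5)] .
  consider "i < l" "j < l" | "i = l" "j < l" | "i < l" "j = l" | "i = l" "j = l"
    using Suc.prems(2,3) by linarith
  then show ?case
    using Suc r c by cases (simp_all add: block_diag_Suc)
qed simp

lemma map_mat_block_diag:
  assumes "\<And>i. i < l \<Longrightarrow> X i \<in> carrier_mat (rs i) (cs i)" and "f 0 = 0"
  shows "map_mat f (block_diag l X) = block_diag l (\<lambda>i. map_mat f (X i))"
  using assms(1)
proof (induction l)
  case (Suc l)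
  have *: "block_diag l X \<in> carrier_mat (part_offset rs l) (part_offset cs l)"
    "X l \<in> carrier_mat (rs l) (cs l)"
    using Suc.prems block_diag_carrier[of l X rs cs] by auto
  have "block_diag l (\<lambda>i. map_mat f (X i)) = map_mat f (block_diag l X)"
    using Suc by simp
  with * show ?case
    unfolding block_diag_Suc by (intro eq_matI) (auto simp: assms(2))
qed (auto simp: block_diag_def intro: eq_matI)

text \<open>Splitting the sum over all rows into parts leaves only part \<open>i\<close>, since the
  other blocks vanish in these columns. Thus a block-diagonal matrix acts on row vectors, written
  here as transpose times column, one part at a time.\<close>

lemma vec_part_block_diag_mult:
  assumes X: "\<And>i. i < l \<Longrightarrow> X i \<in> carrier_mat (rs i) (cs i)"
    and w: "w \<in> carrier_vec (part_offset rs l)" and i: "i < l"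
  shows "vec_part cs ((block_diag l X)\<^sup>T *\<^sub>v w) i = (X i)\<^sup>T *\<^sub>v vec_part rs w i"
proof (rule eq_vecI)
  have D: "block_diag l X \<in> carrier_mat (part_offset rs l) (part_offset cs l)"
    using X by (rule block_diag_carrier)
  fix b assume "b < dim_vec ((X i)\<^sup>T *\<^sub>v vec_part rs w i)"
  then have b: "b < cs i" using X[OF i] by simp
  have c: "part_offset cs i + b < part_offset cs l"
    using part_offset_add_less[where ns = cs, OF i b] .
  have "vec_part cs ((block_diag l X)\<^sup>T *\<^sub>v w) i $ b
      = (\<Sum>x<part_offset rs l. block_diag l X $$ (x, part_offset cs i + b) * w $ x)"
    using D b c w by (simp add: scalar_prod_def atLeast0LessThan)
  also have "\<dots> = (\<Sum>j<l. \<Sum>a<rs j. (if j = i then X j $$ (a, b) * w $ (part_offset rs j + a) else 0))"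
    unfolding sum_parts using b i
    by (intro sum.cong refl) (simp add: block_diag_index[of l X rs cs, OF X])
  also have "\<dots> = (\<Sum>j<l. if j = i then \<Sum>a<rs j. X j $$ (a, b) * w $ (part_offset rs j + a) else 0)"
    by (intro sum.cong) auto
  also have "\<dots> = ((X i)\<^sup>T *\<^sub>v vec_part rs w i) $ b"
    using i b X[OF i] by (simp add: scalar_prod_def atLeast0LessThan)
  finally show "vec_part cs ((block_diag l X)\<^sup>T *\<^sub>v w) i $ b = ((X i)\<^sup>T *\<^sub>v vec_part rs w i) $ b" .
qed (use X[OF i] in simp)

section \<open>Horizontal concatenation and the parts of a codeword\<close>

lemma hconcat_mat_carrier:
  assumes "\<And>i. i < l \<Longrightarrow> Q i \<in> carrier_mat k (ns i)"
  shows "hconcat_mat k (map Q [0..<l]) \<in> carrier_mat k (part_offset ns l)"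
proof -
  have "(\<Sum>i<l. dim_col (Q i)) = part_offset ns l"
    unfolding part_offset_def by (intro sum.cong refl carrier_matD(2)[of _ k] assms) simp
  then show ?thesis
    by (simp add: hconcat_mat_def mat_of_cols_def length_concat o_def
      interv_sum_list_conv_sum_set_nat atLeast0LessThan)
qed

lemma vec_part_hconcat_mult:
  assumes Q: "\<And>i. i < l \<Longrightarrow> Q i \<in> carrier_mat k (ns i)" and i: "i < l"
    and u: "u \<in> carrier_vec k"
  shows "vec_part ns ((hconcat_mat k (map Q [0..<l]))\<^sup>T *\<^sub>v u) i = (Q i)\<^sup>T *\<^sub>v u"
proof (rule eq_vecI)
  fix a assume "a < dim_vec ((Q i)\<^sup>T *\<^sub>v u)"
  then have a: "a < ns i" using Q[OF i] by simp
  have c: "part_offset ns i + a < part_offset ns l"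
    using part_offset_add_less[where ns = ns, OF i a] .
  have len: "length (concat (map (\<lambda>i. cols (Q i)) [0..<l])) = part_offset ns l"
    using carrier_matD(2)[OF hconcat_mat_carrier[of l Q k ns, OF Q]] by (simp add: hconcat_mat_def o_def)
  have "concat (map (\<lambda>i. cols (Q i)) [0..<l]) ! (part_offset ns i + a) = cols (Q i) ! a"
    using i a by (intro nth_concat_parts) (simp_all add: carrier_matD(2)[OF Q])
  then have "col (hconcat_mat k (map Q [0..<l])) (part_offset ns i + a) = col (Q i) a"
    using c Q[OF i] a by (simp add: hconcat_mat_def o_def len col_mat_of_cols)
  then show "vec_part ns ((hconcat_mat k (map Q [0..<l]))\<^sup>T *\<^sub>v u) i $ a = ((Q i)\<^sup>T *\<^sub>v u) $ a"
    using Q[OF i] a c hconcat_mat_carrier[of l Q k ns] Q by simp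
qed (use Q[OF i] in simp)

text \<open>Merging \<open>J_mat k ks i\<close> and \<open>P i\<close> into one block gives a
  concatenation with one block per part of the length partition, the form that
  \<open>vec_part_hconcat_mult\<close> handles.\<close>

lemma systematic_encoder_eq:
  "systematic_encoder k l ks P
     = hconcat_mat k (map (\<lambda>i. mat_of_cols k (cols (J_mat k ks i) @ cols (P i))) [0..<l])"
  if "\<And>i. i < l \<Longrightarrow> P i \<in> carrier_mat k (ms i)"
proof -
  have "cols (mat_of_cols k (cols (J_mat k ks i) @ cols (P i))) = cols (J_mat k ks i) @ cols (P i)"
    if "i < l" for i
    using cols_dim[of "J_mat k ks i :: 'a mat"] cols_dim[of "P i"] \<open>\<And>i. i < l \<Longrightarrow> _\<close>[OF that]
    by (intro cols_mat_of_cols) (auto simp: J_mat_def)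
  then have "map (cols \<circ> (\<lambda>i. mat_of_cols k (cols (J_mat k ks i) @ cols (P i)))) [0..<l]
      = map (\<lambda>i. cols (J_mat k ks i) @ cols (P i)) [0..<l]" by simp
  moreover have "concat (map cols (concat (map (\<lambda>i. [J_mat k ks i, P i]) [0..<l])))
      = concat (map (\<lambda>i. cols (J_mat k ks i) @ cols (P i)) [0..<l])"
    by (induction l) auto
  ultimately show ?thesis
    by (simp only: systematic_encoder_def hconcat_mat_def map_map)
qed

lemma systematic_encoder_carrier:
  assumes "\<And>i. i < l \<Longrightarrow> P i \<in> carrier_mat k (ns i - ks i)" and "\<And>i. i < l \<Longrightarrow> ks i \<le> ns i"
  shows "systematic_encoder k l ks P \<in> carrier_mat k (part_offset ns l)"
proof -
  have "mat_of_cols k (cols (J_mat k ks i) @ cols (P i)) \<in> carrier_mat k (ns i)" if "i < l" for i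
    using assms(1)[OF that] assms(2)[OF that] by (simp add: mat_of_cols_def J_mat_def)
  then show ?thesis
    by (subst systematic_encoder_eq[OF assms(1)]) (auto intro: hconcat_mat_carrier)
qed

text \<open>The columns from \<open>J_mat k ks i\<close> are the unit vectors at
  \<open>part_offset ks i + a\<close>, so they read off the \<open>i\<close>-th part of
  \<open>u\<close>; the remaining columns of the block contribute \<open>u P_i\<close>.\<close>

lemma vec_part_systematic_encoder:
  fixes P :: "nat \<Rightarrow> 'a::field mat"
  assumes P: "\<And>i. i < l \<Longrightarrow> P i \<in> carrier_mat k (ns i - ks i)" and le: "\<And>i. i < l \<Longrightarrow> ks i \<le> ns i"
    and k: "k = part_offset ks l" and u: "u \<in> carrier_vec k" and i: "i < l"
  shows "vec_part ns ((systematic_encoder k l ks P)\<^sup>T *\<^sub>v u) i = vec_part ks u i @\<^sub>v ((P i)\<^sup>T *\<^sub>v u)"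
proof -
  let ?Q = "\<lambda>i. mat_of_cols k (cols (J_mat k ks i) @ cols (P i))"
  have Q: "?Q i \<in> carrier_mat k (ns i)" if "i < l" for i
    using P[OF that] le[OF that] by (simp add: mat_of_cols_def J_mat_def)
  have len: "length (cols (J_mat k ks i :: 'a mat)) = ks i" by (simp add: J_mat_def)
  have *: "((?Q i)\<^sup>T *\<^sub>v u) $ a = (vec_part ks u i @\<^sub>v ((P i)\<^sup>T *\<^sub>v u)) $ a" if a: "a < ns i" for a
  proof (cases "a < ks i")
    case True
    have o: "part_offset ks i + a < k" using part_offset_add_less[where ns = ks, OF i True] k by simp
    have "col (?Q i) a = unit_vec k (part_offset ks i + a)"
      using True a P[OF i] o by (intro eq_vecI)
        (auto simp: mat_of_cols_def J_mat_def nth_append len unit_vec_def)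
    then have "((?Q i)\<^sup>T *\<^sub>v u) $ a = u $ (part_offset ks i + a)"
      using a Q[OF i] scalar_prod_left_unit[OF u o] by (subst index_mult_mat_vec) auto
    then show ?thesis
      using True a P[OF i] by simp
  next
    case False
    then have "col (?Q i) a = col (P i) (a - ks i)"
      using a P[OF i] len by (intro eq_vecI) (auto simp: mat_of_cols_def nth_append)
    then have "((?Q i)\<^sup>T *\<^sub>v u) $ a = col (P i) (a - ks i) \<bullet> u"
      using a Q[OF i] by (subst index_mult_mat_vec) auto
    then show ?thesis
      using False a P[OF i] u by simp
  qed
  have "vec_part ns ((systematic_encoder k l ks P)\<^sup>T *\<^sub>v u) i = (?Q i)\<^sup>T *\<^sub>v u"
    by (subst systematic_encoder_eq[OF P], assumption) (rule vec_part_hconcat_mult[OF Q i u])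
  also have "\<dots> = vec_part ks u i @\<^sub>v ((P i)\<^sup>T *\<^sub>v u)"
    using * Q[OF i] P[OF i] le[OF i] by (intro eq_vecI) auto
  finally show ?thesis .
qed

section \<open>Products, inverses and the dimension of the code\<close>

lemma transpose_mult_add_vec:
  fixes B :: "'a::comm_ring_1 mat"
  assumes B: "B \<in> carrier_mat k k" and P: "P \<in> carrier_mat k m" and A: "A \<in> carrier_mat m m"
    and C: "C \<in> carrier_mat k m" and u: "u \<in> carrier_vec k"
  shows "(B * P * A + C)\<^sup>T *\<^sub>v u = A\<^sup>T *\<^sub>v (P\<^sup>T *\<^sub>v (B\<^sup>T *\<^sub>v u)) + C\<^sup>T *\<^sub>v u"
proof -
  have BP: "B * P \<in> carrier_mat k m" using B P by simp
  have "(B * P * A + C)\<^sup>T = (B * P * A)\<^sup>T + C\<^sup>T"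
    using BP A C by (intro transpose_add) auto
  also have "(B * P * A)\<^sup>T = A\<^sup>T * (P\<^sup>T * B\<^sup>T)"
    using transpose_mult[OF BP A] transpose_mult[OF B P] by simp
  finally have "(B * P * A + C)\<^sup>T *\<^sub>v u = (A\<^sup>T * (P\<^sup>T * B\<^sup>T)) *\<^sub>v u + C\<^sup>T *\<^sub>v u"
    using A P B C u by (simp add: add_mult_distrib_mat_vec[of _ m k])
  also have "(A\<^sup>T * (P\<^sup>T * B\<^sup>T)) *\<^sub>v u = A\<^sup>T *\<^sub>v ((P\<^sup>T * B\<^sup>T) *\<^sub>v u)"
    using A P B u by (intro assoc_mult_mat_vec) auto
  also have "(P\<^sup>T * B\<^sup>T) *\<^sub>v u = P\<^sup>T *\<^sub>v (B\<^sup>T *\<^sub>v u)"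
    using P B u by (intro assoc_mult_mat_vec) auto
  finally show ?thesis .
qed

lemma invertible_mat_obtain:
  assumes "A \<in> carrier_mat n n" "invertible_mat A"
  obtains A' where "A' \<in> carrier_mat n n" "A * A' = 1\<^sub>m n" "A' * A = 1\<^sub>m n"
proof -
  obtain A' where A': "A * A' = 1\<^sub>m n" "A' * A = 1\<^sub>m (dim_row A')"
    using assms by (auto simp: invertible_mat_def inverts_mat_def)
  \<comment> \<open>\<open>inverts_mat\<close> does not fix the shape of \<open>A'\<close>;
    comparing the numbers of columns in the two product equations does.\<close>
  have "dim_row A' = n"
    using arg_cong[OF A'(2), of dim_col] assms(1) by simp
  moreover have "dim_col A' = n"
    using arg_cong[OF A'(1), of dim_col] by simp
  ultimately show ?thesis
    using A' by (intro that[of A'] carrier_matI) simp_all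
qed

text \<open>The determinant is the product of the diagonal entries, hence nonzero, so
  \<open>A\<close> is a unit of the matrix ring.\<close>

lemma invertible_unitriangular:
  fixes A :: "'a::field mat"
  assumes A: "A \<in> carrier_mat n n" and "upper_triangular A" and "\<And>i. i < n \<Longrightarrow> A $$ (i, i) = 1"
  shows "invertible_mat A"
proof -
  have "diag_mat A = replicate n 1"
    using assms(1,3) by (intro nth_equalityI) (auto simp: diag_mat_def)
  then have "det A \<noteq> 0"
    using det_upper_triangular[OF assms(2) A] by simp
  then obtain B where "B \<in> carrier_mat n n" "B * A = 1\<^sub>m n" "A * B = 1\<^sub>m n"
    using det_non_zero_imp_unit[OF A, of "()"] by (auto simp: Units_def ring_mat_simps)
  then show ?thesis
    using A by (auto simp: invertible_mat_def inverts_mat_def intro!: exI[of _ B])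
qed

text \<open>The code is the column space of the transposed encoder, hence a subspace. A trivial
  kernel makes the \<open>k\<close> columns distinct and independent, so the rank, which is the
  dimension of this span, equals \<open>k\<close>.\<close>

lemma code_of_injective:
  fixes G :: "'a::field mat"
  assumes G: "G \<in> carrier_mat k n"
    and inj: "\<And>u. u \<in> carrier_vec k \<Longrightarrow> G\<^sup>T *\<^sub>v u = 0\<^sub>v n \<Longrightarrow> u = 0\<^sub>v k"
  shows "linear_code n (code_of G)" "code_dim n (code_of G) = k"
proof -
  interpret V: vec_space "TYPE('a)" n .
  have GT: "G\<^sup>T \<in> carrier_mat n k" using G by simp
  have cols: "set (cols G\<^sup>T) \<subseteq> carrier_vec n"
    using cols_dim[of "G\<^sup>T"] carrier_matD(1)[OF GT] by metis
  have code: "code_of G = V.span (set (cols G\<^sup>T))"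
    using V.col_space_eq[OF GT] G unfolding V.col_space_def code_of_def by auto
  show "linear_code n (code_of G)"
    unfolding linear_code_def code using V.span_is_subspace[of "set (cols G\<^sup>T)"] cols by simp
  have unit: "G\<^sup>T *\<^sub>v unit_vec k i = col G\<^sup>T i" if "i < k" for i
    using GT that by (intro eq_vecI) auto
  \<comment> \<open>Independence speaks of the set of columns, so repetitions are excluded
    separately: two equal columns would put \<open>unit_vec k i - unit_vec k j\<close> into the
    kernel.\<close>
  have "distinct (cols G\<^sup>T)"
    unfolding distinct_conv_nth
  proof (intro allI impI notI)
    fix i j assume ij: "i < length (cols G\<^sup>T)" "j < length (cols G\<^sup>T)" "i \<noteq> j"
      and eq: "cols G\<^sup>T ! i = cols G\<^sup>T ! j"
    then have ij': "i < k" "j < k" using G by auto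
    have "G\<^sup>T *\<^sub>v (unit_vec k i - unit_vec k j) = G\<^sup>T *\<^sub>v unit_vec k i - G\<^sup>T *\<^sub>v unit_vec k j"
      using GT by (rule mult_minus_distrib_mat_vec) auto
    also have "\<dots> = col G\<^sup>T i - col G\<^sup>T j"
      using ij' GT by (simp add: unit)
    also have "\<dots> = 0\<^sub>v n"
      using eq ij GT ij' by (intro eq_vecI) auto
    finally have "unit_vec k i - unit_vec k j = (0\<^sub>v k :: 'a vec)"
      by (intro inj) auto
    then have "(unit_vec k i - unit_vec k j :: 'a vec) $ i = 0" using ij' by simp
    then show False using ij ij' by simp
  qed
  moreover from this have "V.lin_indpt (set (cols G\<^sup>T))"
    using V.lin_depE[OF GT] inj by metis
  ultimately have "V.rank G\<^sup>T = k"
    by (rule V.lin_indpt_full_rank[OF GT])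
  then show "code_dim n (code_of G) = k"
    unfolding code_dim_def code V.rank_def by simp
qed

section \<open>Superregularity and Hamming weights\<close>

text \<open>If \<open>u\<close> vanishes outside \<open>I\<close>, only the rows in \<open>I\<close>
  contribute to \<open>u X\<close>, so passing to the submatrix changes none of the entries at
  columns in \<open>J\<close>.\<close>

lemma mult_submatrix_transpose:
  fixes X :: "'a::comm_ring_1 mat"
  assumes I: "I \<subseteq> {..<dim_row X}" and J: "J \<subseteq> {..<dim_col X}"
    and u: "u \<in> carrier_vec (dim_row X)" and supp: "\<And>i. i < dim_row X \<Longrightarrow> i \<notin> I \<Longrightarrow> u $ i = 0"
  shows "(submatrix X I J)\<^sup>T *\<^sub>v vec (card I) (\<lambda>i. u $ pick I i)
     = vec (card J) (\<lambda>j. (X\<^sup>T *\<^sub>v u) $ pick J j)"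
proof -
  have fin: "finite I" "finite J"
    using I J by (auto intro: finite_subset)
  have IJ: "{i. i < dim_row X \<and> i \<in> I} = I" "{j. j < dim_col X \<and> j \<in> J} = J"
    using I J by auto
  \<comment> \<open>\<open>pick I\<close> is strictly increasing with values in \<open>I\<close>;
    counting then gives surjectivity.\<close>
  have pick: "bij_betw (pick I) {..<card I} I"
  proof (rule bij_betw_imageI)
    show "inj_on (pick I) {..<card I}"
      by (rule inj_onI) (metis lessThan_iff nat_neq_iff pick_mono_le)
    then show "pick I ` {..<card I} = I"
      using fin by (intro card_subset_eq) (auto simp: card_image pick_in_set_le)
  qed
  show ?thesis
  proof (rule eq_vecI)
    fix j assume "j < dim_vec (vec (card J) (\<lambda>j. (X\<^sup>T *\<^sub>v u) $ pick J j))"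
    then have j: "j < card J" by simp
    then have pj: "pick J j < dim_col X" using pick_in_set_le[OF j] J by auto
    have "((submatrix X I J)\<^sup>T *\<^sub>v vec (card I) (\<lambda>i. u $ pick I i)) $ j
        = (\<Sum>i<card I. X $$ (pick I i, pick J j) * u $ pick I i)"
      using j by (simp add: scalar_prod_def submatrix_def IJ atLeast0LessThan)
    also have "\<dots> = (\<Sum>i\<in>I. X $$ (i, pick J j) * u $ i)"
      using sum.reindex_bij_betw[OF pick, of "\<lambda>i. X $$ (i, pick J j) * u $ i"] .
    also have "\<dots> = (\<Sum>i<dim_row X. X $$ (i, pick J j) * u $ i)"
      using I supp by (intro sum.mono_neutral_left) auto
    also have "\<dots> = (X\<^sup>T *\<^sub>v u) $ pick J j"
      using pj u by (simp add: scalar_prod_def atLeast0LessThan)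
    finally show "((submatrix X I J)\<^sup>T *\<^sub>v vec (card I) (\<lambda>i. u $ pick I i)) $ j
        = vec (card J) (\<lambda>j. (X\<^sup>T *\<^sub>v u) $ pick J j) $ j"
      using j by simp
  qed (simp add: submatrix_def IJ)
qed

text \<open>A vanishing minor means a nontrivial relation between the rows of the submatrix.
  Extending its coefficients by zero outside \<open>I\<close> gives \<open>u\<close>, and
  restricting \<open>u\<close> to \<open>I\<close> goes back.\<close>

lemma det_submatrix_eq_0_iff:
  fixes X :: "'a::field mat"
  assumes I: "I \<subseteq> {..<dim_row X}" and J: "J \<subseteq> {..<dim_col X}" and card: "card I = card J"
  shows "det (submatrix X I J) = 0 \<longleftrightarrow>
    (\<exists>u\<in>carrier_vec (dim_row X). u \<noteq> 0\<^sub>v (dim_row X) \<and>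
       (\<forall>i<dim_row X. i \<notin> I \<longrightarrow> u $ i = 0) \<and> (\<forall>j\<in>J. (X\<^sup>T *\<^sub>v u) $ j = 0))"
proof -
  have fin: "finite I" "finite J"
    using I J by (auto intro: finite_subset)
  have IJ: "{i. i < dim_row X \<and> i \<in> I} = I" "{j. j < dim_col X \<and> j \<in> J} = J"
    using I J by auto
  have S: "submatrix X I J \<in> carrier_mat (card I) (card I)"
    by (rule carrier_matI) (simp_all only: dim_submatrix IJ card)
  \<comment> \<open>The position of \<open>x\<close> in \<open>K\<close> is the number of smaller
    elements of \<open>K\<close>.\<close>
  have pick_surj: "\<exists>a<card K. pick K a = x" if "finite K" "x \<in> K" for K x
  proof (intro exI conjI)
    show "card {a \<in> K. a < x} < card K"
      by (rule psubset_card_mono[OF that(1)]) (use that(2) in blast)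
    show "pick K (card {a \<in> K. a < x}) = x"
      using pick_card_in_set[OF that(2)] .
  qed
  have "det (submatrix X I J) = 0 \<longleftrightarrow> det (submatrix X I J)\<^sup>T = 0"
    using det_transpose[OF S] by simp
  also have "\<dots> \<longleftrightarrow> (\<exists>x\<in>carrier_vec (card I). x \<noteq> 0\<^sub>v (card I) \<and> (submatrix X I J)\<^sup>T *\<^sub>v x = 0\<^sub>v (card I))"
    unfolding Bex_def using det_0_iff_vec_prod_zero_field[of "(submatrix X I J)\<^sup>T" "card I"] S
    by (simp only: transpose_carrier_mat)
  also have "\<dots> \<longleftrightarrow> (\<exists>u\<in>carrier_vec (dim_row X). u \<noteq> 0\<^sub>v (dim_row X) \<and>
       (\<forall>i<dim_row X. i \<notin> I \<longrightarrow> u $ i = 0) \<and> (\<forall>j\<in>J. (X\<^sup>T *\<^sub>v u) $ j = 0))" (is "?l \<longleftrightarrow> ?r")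
  proof
    assume ?l
    then obtain x where x: "x \<in> carrier_vec (card I)" "x \<noteq> 0\<^sub>v (card I)"
      "(submatrix X I J)\<^sup>T *\<^sub>v x = 0\<^sub>v (card I)" by blast
    \<comment> \<open>Extension of \<open>x\<close> by zero: \<open>card {a \<in> I. a < i}\<close>
      is the position of \<open>i\<close> in \<open>I\<close>, so reading \<open>u\<close> along
      \<open>pick I\<close> recovers \<open>x\<close>.\<close>
    define u where "u = vec (dim_row X) (\<lambda>i. if i \<in> I then x $ card {a \<in> I. a < i} else 0)"
    have u_pick: "u $ pick I i = x $ i" if "i < card I" for i
      using pick_in_set_le[OF that] I that by (auto simp: u_def card_pick_le)
    have xu: "x = vec (card I) (\<lambda>i. u $ pick I i)"
      using x(1) u_pick by (intro eq_vecI) auto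
    have eq: "vec (card J) (\<lambda>j. (X\<^sup>T *\<^sub>v u) $ pick J j) = 0\<^sub>v (card I)"
      using mult_submatrix_transpose[OF I J, of u] x(3) xu by (simp add: u_def)
    have "(X\<^sup>T *\<^sub>v u) $ j = 0" if j: "j \<in> J" for j
    proof -
      obtain b where b: "b < card J" "pick J b = j" using pick_surj[OF fin(2) j] by blast
      then show ?thesis using arg_cong[OF eq, of "\<lambda>v. v $ b"] card by simp
    qed
    moreover have "u \<noteq> 0\<^sub>v (dim_row X)"
    proof
      assume "u = 0\<^sub>v (dim_row X)"
      then have "x $ i = 0" if "i < card I" for i
        using u_pick[OF that] pick_in_set_le[OF that] I by auto
      then show False using x(1,2) by (auto intro!: eq_vecI)
    qed
    ultimately show ?r
      by (intro bexI[of _ u]) (auto simp: u_def)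
  next
    assume ?r
    then obtain u where u: "u \<in> carrier_vec (dim_row X)" "u \<noteq> 0\<^sub>v (dim_row X)"
      "\<And>i. i < dim_row X \<Longrightarrow> i \<notin> I \<Longrightarrow> u $ i = 0" "\<And>j. j \<in> J \<Longrightarrow> (X\<^sup>T *\<^sub>v u) $ j = 0" by blast
    from u(1,2) obtain i where i: "i < dim_row X" "u $ i \<noteq> 0"
      by (metis carrier_vecD eq_vecI index_zero_vec)
    then obtain a where a: "a < card I" "pick I a = i"
      using u(3) pick_surj[OF fin(1), of i] by blast
    let ?x = "vec (card I) (\<lambda>i. u $ pick I i)"
    have "?x \<noteq> 0\<^sub>v (card I)"
      using a i by (metis index_vec index_zero_vec(1))
    moreover have "(submatrix X I J)\<^sup>T *\<^sub>v ?x = 0\<^sub>v (card I)"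
      unfolding mult_submatrix_transpose[OF I J u(1,3), simplified] using u(4) card
      by (intro eq_vecI) (auto simp: pick_in_set_le)
    ultimately show ?l by (intro bexI[of _ ?x]) auto
  qed
  finally show ?thesis .
qed

text \<open>If the weights of \<open>u\<close> and \<open>u X\<close> add up to at most
  \<open>dim_col X\<close>, then \<open>u X\<close> has at least as many zeros as \<open>u\<close>
  has nonzero entries; equally many of these columns, with the support of \<open>u\<close> as rows,
  give a vanishing minor. Conversely, a vanishing minor on \<open>I\<close> and \<open>J\<close>
  gives a nonzero \<open>u\<close> with weights at most \<open>card I\<close> and
  \<open>dim_col X - card J\<close>. This is the criterion for \<open>[1, X]\<close> to generate an
  MDS code in the Hamming metric.\<close>

lemma full_superregular_iff_weight:
  fixes X :: "'a::field mat"
  shows "full_superregular X \<longleftrightarrow>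
    (\<forall>u\<in>carrier_vec (dim_row X). u \<noteq> 0\<^sub>v (dim_row X) \<longrightarrow>
       dim_col X < hamming_weight u + hamming_weight (X\<^sup>T *\<^sub>v u))"
proof
  assume sr: "full_superregular X"
  show "\<forall>u\<in>carrier_vec (dim_row X). u \<noteq> 0\<^sub>v (dim_row X) \<longrightarrow>
       dim_col X < hamming_weight u + hamming_weight (X\<^sup>T *\<^sub>v u)"
  proof (intro ballI impI, rule ccontr)
    fix u assume u: "u \<in> carrier_vec (dim_row X)" "u \<noteq> 0\<^sub>v (dim_row X)"
      and "\<not> dim_col X < hamming_weight u + hamming_weight (X\<^sup>T *\<^sub>v u)"
    then have le: "hamming_weight u + hamming_weight (X\<^sup>T *\<^sub>v u) \<le> dim_col X" by simp
    let ?I = "{i. i < dim_row X \<and> u $ i \<noteq> 0}"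
    let ?N = "{j. j < dim_col X \<and> (X\<^sup>T *\<^sub>v u) $ j \<noteq> 0}"
    let ?Z = "{..<dim_col X} - ?N"
    have "hamming_weight u = card ?I" "hamming_weight (X\<^sup>T *\<^sub>v u) = card ?N"
      using u by (simp_all add: hamming_weight_def)
    moreover have "card ?Z = dim_col X - card ?N"
      by (subst card_Diff_subset) auto
    ultimately have "card ?I \<le> card ?Z" using le by linarith
    then obtain J where J: "J \<subseteq> ?Z" "card J = card ?I"
      by (meson obtain_subset_with_card_n)
    have sub: "?I \<subseteq> {..<dim_row X}" "J \<subseteq> {..<dim_col X}"
      using J(1) by auto
    have "?I \<noteq> {}"
    proof
      assume "?I = {}"
      then have "u = 0\<^sub>v (dim_row X)"
        using u(1) by (intro eq_vecI) auto
      with u(2) show False ..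
    qed
    then have "det (submatrix X ?I J) \<noteq> 0"
      using sr sub J(2) unfolding full_superregular_def by metis
    moreover have "det (submatrix X ?I J) = 0"
      using J u by (subst det_submatrix_eq_0_iff[OF sub]) (auto intro!: bexI[of _ u])
    ultimately show False by contradiction
  qed
next
  assume wt: "\<forall>u\<in>carrier_vec (dim_row X). u \<noteq> 0\<^sub>v (dim_row X) \<longrightarrow>
       dim_col X < hamming_weight u + hamming_weight (X\<^sup>T *\<^sub>v u)"
  show "full_superregular X"
    unfolding full_superregular_def
  proof (intro allI impI notI, elim conjE)
    fix I J assume I: "I \<subseteq> {..<dim_row X}" and J: "J \<subseteq> {..<dim_col X}"
      and card: "card I = card J" and "det (submatrix X I J) = 0"
    then obtain u where u: "u \<in> carrier_vec (dim_row X)" "u \<noteq> 0\<^sub>v (dim_row X)"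
      "\<And>i. i < dim_row X \<Longrightarrow> i \<notin> I \<Longrightarrow> u $ i = 0" "\<And>j. j \<in> J \<Longrightarrow> (X\<^sup>T *\<^sub>v u) $ j = 0"
      using det_submatrix_eq_0_iff[OF I J card] by blast
    have fin: "finite I" "finite J"
      using I J by (auto intro: finite_subset)
    have "hamming_weight u \<le> card I"
      unfolding hamming_weight_def using u(1,3) fin by (intro card_mono) auto
    moreover have "hamming_weight (X\<^sup>T *\<^sub>v u) \<le> card ({..<dim_col X} - J)"
      unfolding hamming_weight_def using u(4) by (intro card_mono) auto
    moreover have "card ({..<dim_col X} - J) = dim_col X - card J"
      using card_Diff_subset[OF fin(2) J] by simp
    moreover have "card J \<le> dim_col X"
      using card_mono[OF _ J] by simp
    moreover have "dim_col X < hamming_weight u + hamming_weight (X\<^sup>T *\<^sub>v u)"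
      using wt u(1,2) by blast
    ultimately show False using card by linarith
  qed
qed

section \<open>Rank weights\<close>

locale ext_field = field_hom emb for emb :: "'f::field \<Rightarrow> 'a::field" +
  fixes bs :: "'a list"
  assumes basis: "ext_basis emb bs"
begin

sublocale VS: Vector_Spaces.vector_space "ext_scale emb"
  by unfold_locales (simp_all add: ext_scale_def algebra_simps hom_distribs)

text \<open>These are the columns of \<open>expand_mat\<close>; naming them lets independence over
  the small field pass between field elements and columns.\<close>

definition coords :: "'a \<Rightarrow> 'f vec" where
  "coords x = vec (length bs) (\<lambda>i. VS.representation (set bs) x (bs ! i))"

lemma bs: "distinct bs" "VS.independent (set bs)" "VS.span (set bs) = UNIV"
  using basis unfolding ext_basis_def by auto

lemma coords_carrier [simp]: "coords x \<in> carrier_vec (length bs)"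
  by (simp add: coords_def)

lemma dim_coords [simp]: "dim_vec (coords x) = length bs"
  by (simp add: coords_def)

lemma coords_sum:
  assumes "i < length bs"
  shows "coords (\<Sum>x\<in>S. ext_scale emb (c x) x) $ i = (\<Sum>x\<in>S. c x * coords x $ i)"
  using assms bs by (simp add: coords_def VS.representation_sum VS.representation_scale)

lemma coords_eq_0_iff: "coords x = 0\<^sub>v (length bs) \<longleftrightarrow> x = 0"
proof
  assume "coords x = 0\<^sub>v (length bs)"
  hence *: "coords x $ i = 0" if "i < length bs" for i
    using that by simp
  have "VS.representation (set bs) x b = 0" if "b \<in> set bs" for b
    using that * by (auto simp: in_set_conv_nth coords_def)
  hence "(\<Sum>b\<in>set bs. ext_scale emb (VS.representation (set bs) x b) b) = 0"
    by (intro sum.neutral) auto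
  thus "x = 0"
    using VS.sum_representation_eq[of "set bs" x "set bs"] bs by simp
qed (auto simp: coords_def VS.representation_zero)

lemma inj_coords: "inj coords"
proof (rule injI)
  fix x y assume *: "coords x = coords y"
  have "coords (x - y) = coords x - coords y"
    using bs by (intro eq_vecI) (auto simp: coords_def VS.representation_diff)
  also have "\<dots> = 0\<^sub>v (length bs)"
    unfolding * by (rule minus_cancel_vec) simp
  finally show "x = y"
    by (simp add: coords_eq_0_iff)
qed

lemma cols_expand_mat: "cols (expand_mat emb bs v) = map coords (list_of_vec v)"
  by (rule nth_equalityI) (auto simp: expand_mat_def coords_def list_of_vec_index)

text \<open>\<open>coords\<close> is linear over the small field and injective, so linear relations
  can be carried over in both directions with the same coefficients.\<close>

lemma lin_dep_coords_iff:
  assumes "finite S"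
  shows "LinearCombinations.module.lin_dep class_ring (module_vec TYPE('f) (length bs)) (coords ` S)
     \<longleftrightarrow> VS.dependent S"
proof -
  interpret V: vec_space "TYPE('f)" "length bs" .
  have lincomb: "V.lincomb a (coords ` S) = coords (\<Sum>x\<in>S. ext_scale emb (a (coords x)) x)" for a
    by (intro eq_vecI)
      (simp_all add: V.lincomb_index V.lincomb_dim assms image_subset_iff coords_sum
        sum.reindex[OF inj_on_subset[OF inj_coords]])
  show ?thesis
  proof
    assume "V.lin_dep (coords ` S)"
    then obtain a y where a: "V.lincomb a (coords ` S) = 0\<^sub>v (length bs)" "y \<in> coords ` S" "a y \<noteq> 0"
      using V.finite_lin_dep[of "coords ` S"] assms by (auto simp: image_subset_iff)
    then show "VS.dependent S"
      unfolding lincomb coords_eq_0_iff VS.dependent_finite[OF assms]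
      by (intro exI[of _ "\<lambda>x. a (coords x)"]) auto
  next
    assume "VS.dependent S"
    then obtain u x where u: "(\<Sum>x\<in>S. ext_scale emb (u x) x) = 0" "x \<in> S" "u x \<noteq> 0"
      by (auto simp: VS.dependent_finite[OF assms])
    \<comment> \<open>Coefficients of \<open>lincomb\<close> are indexed by the vectors themselves,
      hence the composition of \<open>u\<close> with the inverse of \<open>coords\<close>.\<close>
    show "V.lin_dep (coords ` S)"
    proof (rule V.lin_dep_crit[where A = "coords ` S" and a = "u \<circ> inv_into UNIV coords" and v = "coords x"])
      show "V.lincomb (u \<circ> inv_into UNIV coords) (coords ` S) = 0\<^sub>v (length bs)"
        unfolding lincomb using u(1) by (simp add: inj_coords coords_eq_0_iff)
    qed (use assms u in \<open>auto simp: inj_coords\<close>)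
  qed
qed

lemma expand_mat_carrier: "expand_mat emb bs v \<in> carrier_mat (length bs) (dim_vec v)"
  by (simp add: expand_mat_def)

lemma set_cols_expand_mat: "set (cols (expand_mat emb bs v)) = coords ` set\<^sub>v v"
  by (simp add: cols_expand_mat set_list_of_vec)

section \<open>Rank weight as the dimension of the span of the entries\<close>

lemma rank_weight_ge:
  assumes "T \<subseteq> set\<^sub>v v" and "VS.independent T"
  shows "card T \<le> rank_weight emb bs v"
proof -
  interpret V: vec_space "TYPE('f)" "length bs" .
  have "finite T"
    using assms(1) by (rule finite_subset) (simp flip: set_list_of_vec)
  then have "V.lin_indpt (coords ` T)"
    using lin_dep_coords_iff[of T] assms(2) by simp
  then have "card (coords ` T) \<le> V.rank (expand_mat emb bs v)"
    using assms(1) by (intro V.rank_ge_card_indpt[OF expand_mat_carrier])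
      (auto simp: set_cols_expand_mat)
  then show ?thesis
    by (simp add: rank_weight_def card_image inj_on_subset[OF inj_coords])
qed

text \<open>A maximal independent set of columns has as many elements as the rank. It comes from an
  independent set of entries inside the span of \<open>S\<close>, which the exchange argument bounds
  by \<open>card S\<close>.\<close>

lemma rank_weight_le:
  assumes "set\<^sub>v v \<subseteq> VS.span S" and "finite S"
  shows "rank_weight emb bs v \<le> card S"
proof -
  interpret V: vec_space "TYPE('f)" "length bs" .
  let ?cs = "set (cols (expand_mat emb bs v))"
  have "V.lin_indpt {}"
    by (simp add: V.lin_dep_def)
  then obtain U where U: "maximal U (\<lambda>T. T \<subseteq> ?cs \<and> V.lin_indpt T)"
    using maximal_exists_superset[of ?cs "\<lambda>T. T \<subseteq> ?cs \<and> V.lin_indpt T" "{}"] by auto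
  then have "U \<subseteq> coords ` set\<^sub>v v" and indpt: "V.lin_indpt U"
    by (auto simp: maximal_def set_cols_expand_mat)
  then obtain T where T: "T \<subseteq> set\<^sub>v v" "U = coords ` T"
    by (auto simp: subset_image_iff)
  have "finite T"
    using T(1) by (rule finite_subset) (simp flip: set_list_of_vec)
  with indpt T have "VS.independent T"
    using lin_dep_coords_iff[of T] by simp
  then have "card T \<le> card S"
    using VS.independent_span_bound[OF assms(2)] T(1) assms(1) by blast
  moreover have "rank_weight emb bs v = card U"
    unfolding rank_weight_def by (rule V.rank_card_indpt[OF expand_mat_carrier U])
  ultimately show ?thesis
    by (simp add: T card_image inj_on_subset[OF inj_coords])
qed

section \<open>Combinations over the small field and pivot positions\<close>

lemma span_lessThan_obtain:
  assumes "x \<in> VS.span (f ` {..<m::nat})"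
  obtains c where "x = (\<Sum>i<m. emb (c i) * f i)"
proof -
  have "\<exists>c. x = (\<Sum>i<m. emb (c i) * f i)"
    using assms
  proof (induction m arbitrary: x)
    case (Suc m)
    then obtain d where "x - ext_scale emb d (f m) \<in> VS.span (f ` {..<m})"
      by (auto simp: lessThan_Suc VS.span_breakdown_eq)
    with Suc.IH obtain c where c: "x - ext_scale emb d (f m) = (\<Sum>i<m. emb (c i) * f i)"
      by blast
    have "(\<Sum>i<m. emb ((c(m := d)) i) * f i) = (\<Sum>i<m. emb (c i) * f i)"
      by (rule sum.cong) auto
    then have "x = (\<Sum>i<Suc m. emb ((c(m := d)) i) * f i)"
      using c by (simp add: ext_scale_def algebra_simps)
    then show ?case by blast
  qed auto
  then show ?thesis using that by blast
qed

lemma sum_in_span: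
  assumes "\<And>i. i \<in> I \<Longrightarrow> f i \<in> VS.span S"
  shows "(\<Sum>i\<in>I. emb (c i) * f i) \<in> VS.span S"
proof (rule VS.span_sum)
  show "emb (c i) * f i \<in> VS.span S" if "i \<in> I" for i
    using VS.span_scale[OF assms[OF that], of "c i"] by (simp add: ext_scale_def)
qed

text \<open>These are the pivots of a left-to-right elimination: the positions at which the span of
  the initial segment grows.\<close>

definition new_index :: "(nat \<Rightarrow> 'a) \<Rightarrow> nat \<Rightarrow> bool" where
  "new_index f j \<longleftrightarrow> f j \<notin> VS.span (f ` {..<j})"

text \<open>A value at a new index lies outside the span of all earlier values, in particular of the
  selected ones. So it differs from them and can be added to an independent set.\<close>

lemma new_indices_independent:
  "inj_on f {j. j < n \<and> new_index f j} \<and> VS.independent (f ` {j. j < n \<and> new_index f j})"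
proof (induction n)
  case (Suc n)
  let ?F = "{j. j < n \<and> new_index f j}"
  show ?case
  proof (cases "new_index f n")
    case True
    then have "{j. j < Suc n \<and> new_index f j} = insert n ?F"
      by (auto simp: less_Suc_eq)
    moreover have "f n \<notin> VS.span (f ` ?F)"
      using True VS.span_mono[of "f ` ?F" "f ` {..<n}"] by (auto simp: new_index_def)
    ultimately show ?thesis
      using Suc VS.span_superset[of "f ` ?F"]
      by (auto simp: VS.independent_insert)
  next
    case False
    then have "{j. j < Suc n \<and> new_index f j} = ?F"
      by (auto simp: less_Suc_eq)
    with Suc show ?thesis by simp
  qed
qed (simp add: VS.independent_empty)

lemma card_new_indices_le:
  "card {j. j < dim_vec v \<and> new_index (\<lambda>j. v $ j) j} \<le> rank_weight emb bs v"
proof -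
  let ?F = "{j. j < dim_vec v \<and> new_index (\<lambda>j. v $ j) j}"
  have "card ((\<lambda>j. v $ j) ` ?F) \<le> rank_weight emb bs v"
    by (rule rank_weight_ge) (use new_indices_independent in \<open>auto simp: vec_set_def\<close>)
  then show ?thesis
    using new_indices_independent[of "\<lambda>j. v $ j" "dim_vec v"] by (simp add: card_image)
qed

lemma mult_map_mat_in_span:
  assumes "X \<in> carrier_mat r s" and "v \<in> carrier_vec r" and "\<And>i. i < r \<Longrightarrow> v $ i \<in> VS.span S"
    and "j < s"
  shows "((map_mat emb X)\<^sup>T *\<^sub>v v) $ j \<in> VS.span S"
proof -
  have "((map_mat emb X)\<^sup>T *\<^sub>v v) $ j = (\<Sum>i<r. emb (X $$ (i, j)) * v $ i)"
    using assms by (simp add: scalar_prod_def atLeast0LessThan)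
  also have "\<dots> \<in> VS.span S"
    using assms(3) by (intro sum_in_span) auto
  finally show ?thesis .
qed

lemma map_mat_inverse_transpose:
  assumes "A \<in> carrier_mat s s" "A' \<in> carrier_mat s s" "A * A' = 1\<^sub>m s" "p \<in> carrier_vec s"
  shows "(map_mat emb A')\<^sup>T *\<^sub>v ((map_mat emb A)\<^sup>T *\<^sub>v p) = p"
proof -
  have "(map_mat emb A')\<^sup>T * (map_mat emb A)\<^sup>T = (map_mat emb (A * A'))\<^sup>T"
    using assms(1,2) by (simp add: mat_hom_mult[OF assms(1,2)] transpose_mult[of _ s s _ s])
  also have "\<dots> = 1\<^sub>m s"
    by (simp add: assms(3) mat_hom_one)
  finally show ?thesis
    using assms by (subst assoc_mult_mat_vec[of _ s s _ s, symmetric]) auto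
qed

text \<open>Zero entries of \<open>w\<close> add nothing to a span, so the entries of
  \<open>v\<close> are already spanned by the nonzero entries of \<open>w\<close>.\<close>

lemma rank_weight_le_hamming_weight:
  assumes "\<And>j. j < dim_vec v \<Longrightarrow> v $ j \<in> VS.span {w $ i | i. i < dim_vec w}"
  shows "rank_weight emb bs v \<le> hamming_weight w"
proof -
  let ?S = "(\<lambda>i. w $ i) ` {i. i < dim_vec w \<and> w $ i \<noteq> 0}"
  have "w $ i \<in> VS.span ?S" if "i < dim_vec w" for i
    using that by (cases "w $ i = 0") (auto intro: VS.span_base simp: VS.span_zero)
  then have "VS.span {w $ i | i. i < dim_vec w} \<subseteq> VS.span ?S"
    by (intro VS.span_minimal VS.subspace_span) auto
  then have "rank_weight emb bs v \<le> card ?S"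
    using assms by (intro rank_weight_le) (auto simp: vec_set_def)
  also have "\<dots> \<le> hamming_weight w"
    unfolding hamming_weight_def by (rule card_image_le) simp
  finally show ?thesis .
qed

lemma rank_weight_le_self: "rank_weight emb bs v \<le> hamming_weight v"
  by (rule rank_weight_le_hamming_weight, rule VS.span_base) blast

text \<open>Let \<open>y = p A + u C\<close>. All entries of \<open>(u B, p)\<close> are spanned by
  those of \<open>(u, y)\<close>: those of \<open>u B\<close> directly, those of
  \<open>p A = y - u C\<close> by subtraction, and those of \<open>p\<close> by inverting
  \<open>A\<close>. This is one block of the implication from MSRD to superregularity.\<close>

lemma rank_weight_block_transform_le:
  assumes B: "B \<in> carrier_mat r r" and A: "A \<in> carrier_mat s s" "invertible_mat A"
    and C: "C \<in> carrier_mat r s" and u: "u \<in> carrier_vec r" and p: "p \<in> carrier_vec s"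
  shows "rank_weight emb bs (((map_mat emb B)\<^sup>T *\<^sub>v u) @\<^sub>v p)
    \<le> hamming_weight u + hamming_weight ((map_mat emb A)\<^sup>T *\<^sub>v p + (map_mat emb C)\<^sup>T *\<^sub>v u)"
proof -
  define y where "y = (map_mat emb A)\<^sup>T *\<^sub>v p + (map_mat emb C)\<^sup>T *\<^sub>v u"
  have y: "y \<in> carrier_vec s" using A C u p by (simp add: y_def)
  let ?S = "{(u @\<^sub>v y) $ i | i. i < dim_vec (u @\<^sub>v y)}"
  have uS: "u $ i \<in> VS.span ?S" if "i < r" for i
    using that u y by (intro VS.span_base) (auto intro!: exI[of _ i])
  have yS: "y $ i \<in> VS.span ?S" if "i < s" for i
    using that u y by (intro VS.span_base) (auto intro!: exI[of _ "r + i"])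
  have ApS: "((map_mat emb A)\<^sup>T *\<^sub>v p) $ i \<in> VS.span ?S" if "i < s" for i
  proof -
    have "((map_mat emb A)\<^sup>T *\<^sub>v p) $ i = y $ i - ((map_mat emb C)\<^sup>T *\<^sub>v u) $ i"
      using that A C by (simp add: y_def)
    then show ?thesis
      using VS.span_diff[OF yS[OF that] mult_map_mat_in_span[OF C u uS that]] by simp
  qed
  obtain A' where A': "A' \<in> carrier_mat s s" "A * A' = 1\<^sub>m s"
    by (rule invertible_mat_obtain[OF A])
  have p_eq: "p = (map_mat emb A')\<^sup>T *\<^sub>v ((map_mat emb A)\<^sup>T *\<^sub>v p)"
    by (rule map_mat_inverse_transpose[OF A(1) A' p, symmetric])
  have pS: "p $ i \<in> VS.span ?S" if "i < s" for i
    by (subst p_eq, rule mult_map_mat_in_span[OF A'(1) _ ApS that]) (use A p in auto)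
  have "rank_weight emb bs (((map_mat emb B)\<^sup>T *\<^sub>v u) @\<^sub>v p) \<le> hamming_weight (u @\<^sub>v y)"
  proof (rule rank_weight_le_hamming_weight)
    fix j assume "j < dim_vec (((map_mat emb B)\<^sup>T *\<^sub>v u) @\<^sub>v p)"
    then show "(((map_mat emb B)\<^sup>T *\<^sub>v u) @\<^sub>v p) $ j \<in> VS.span ?S"
      using B p pS[of "j - r"] mult_map_mat_in_span[OF B u uS, of j] by (cases "j < r") auto
  qed
  then show ?thesis
    by (simp add: hamming_weight_append y_def)
qed

section \<open>Triangular elimination in one block\<close>

definition reduced :: "(nat \<Rightarrow> 'a) \<Rightarrow> nat \<Rightarrow> 'a" where
  "reduced f j = (if new_index f j then f j else 0)"

text \<open>An entry replaced by 0 is a combination of strictly earlier entries, which by strong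
  induction are spanned by the reduced ones; so the reduction loses nothing of the span.\<close>

lemma in_span_reduced: "i < j \<Longrightarrow> f i \<in> VS.span (reduced f ` {..<j})"
proof (induction i arbitrary: j rule: less_induct)
  case (less i)
  show ?case
  proof (cases "new_index f i")
    case True
    then have "f i = reduced f i" by (simp add: reduced_def)
    then show ?thesis using less.prems by (auto intro: VS.span_base)
  next
    case False
    then have "f i \<in> VS.span (f ` {..<i})" by (simp add: new_index_def)
    moreover have "f ` {..<i} \<subseteq> VS.span (reduced f ` {..<j})" using less by auto
    ultimately show ?thesis
      by (meson VS.span_minimal VS.subspace_span subsetD)
  qed
qed

text \<open>The vector \<open>u'\<close> consists of the reduced entries of \<open>u\<close>, and the vector under the second
  Hamming weight of the reduced entries of \<open>p\<close>.\<close>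

lemma block_elimination:
  assumes u: "u \<in> carrier_vec r" and p: "p \<in> carrier_vec s"
  obtains B C A u' where
    "B \<in> carrier_mat r r" "upper_triangular B" "invertible_mat B" "C \<in> carrier_mat r s"
    "A \<in> carrier_mat s s" "upper_triangular A" "invertible_mat A"
    "u' \<in> carrier_vec r" "u = (map_mat emb B)\<^sup>T *\<^sub>v u'"
    "hamming_weight u' + hamming_weight ((map_mat emb A)\<^sup>T *\<^sub>v p + (map_mat emb C)\<^sup>T *\<^sub>v u')
       \<le> rank_weight emb bs (u @\<^sub>v p)"
proof -
  define f where "f = (\<lambda>j. (u @\<^sub>v p) $ j)"
  define g where "g = reduced f"
  \<comment> \<open>In the final matrix identity \<open>B\<close> and \<open>C\<close> act on the
    reduced vector \<open>u'\<close>, but \<open>A\<close> acts on \<open>p\<close> itself. So the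
    coefficients are taken with respect to this mixed sequence, reduced before \<open>r\<close> and
    unchanged from \<open>r\<close> on.\<close>
  define h where "h i = (if i < r then g i else f i)" for i
  have fu: "f j = u $ j" if "j < r" for j using that u p by (simp add: f_def)
  have fp: "f (r + j) = p $ j" if "j < s" for j using that u p by (simp add: f_def)
  \<comment> \<open>The mixed sequence spans all earlier entries: those before \<open>r\<close> by
    \<open>in_span_reduced\<close>, the others because \<open>h\<close> keeps them.\<close>
  have span: "f j \<in> VS.span (h ` {..<j})" if "\<not> new_index f j" for j
  proof -
    have "f i \<in> VS.span (h ` {..<j})" if ij: "i < j" for i
    proof (cases "i < r")
      case True
      have "reduced f ` {..<Suc i} \<subseteq> h ` {..<j}"
        using True ij by (auto simp: h_def g_def intro!: image_eqI)
      then show ?thesis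
        using in_span_reduced[of i "Suc i" f] VS.span_mono by blast
    next
      case False
      then have "f i = h i" by (simp add: h_def)
      then show ?thesis using ij by (auto intro: VS.span_base)
    qed
    then have "VS.span (f ` {..<j}) \<subseteq> VS.span (h ` {..<j})"
      by (intro VS.span_minimal VS.subspace_span) auto
    then show ?thesis using that by (auto simp: new_index_def)
  qed
  have "\<exists>c. \<not> new_index f j \<longrightarrow> f j = (\<Sum>i<j. emb (c i) * h i)" for j
    using span_lessThan_obtain[OF span, of j] by metis
  then obtain c where c: "\<And>j. \<not> new_index f j \<Longrightarrow> f j = (\<Sum>i<j. emb (c j i) * h i)"
    by metis
  \<comment> \<open>Zero coefficients at pivots make one equation for \<open>f j\<close> valid at
    every position.\<close>
  define d where "d j i = (if new_index f j then 0 else c j i)" for j i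
  have d: "f j = g j + (\<Sum>i<j. emb (d j i) * h i)" for j
    using c[of j] by (simp add: d_def g_def reduced_def)
  \<comment> \<open>\<open>B\<close> rebuilds \<open>u\<close> from its reduced entries, hence the
    sign plus. \<open>A\<close> and \<open>C\<close> subtract the dependence of \<open>p\<close> on
    earlier entries, hence minus. Position \<open>r + i\<close> precedes \<open>r + j\<close> only
    for \<open>i < j\<close>, which makes \<open>A\<close> triangular, whereas every position before
    \<open>r\<close> precedes \<open>r + j\<close>, so \<open>C\<close> has no such
    restriction.\<close>
  define B where "B = mat r r (\<lambda>(i, j). if i = j then 1 else if i < j then d j i else 0)"
  define A where "A = mat s s (\<lambda>(i, j). if i = j then 1 else if i < j then - d (r + j) (r + i) else 0)"
  define C where "C = mat r s (\<lambda>(i, j). - d (r + j) i)"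
  define u' where "u' = vec r g"
  define p' where "p' = vec s (\<lambda>j. g (r + j))"
  have triangular_sum: "(\<Sum>i<m. emb (if i = j then 1 else if i < j then e i else 0) * x i)
      = x j + (\<Sum>i<j. emb (e i) * x i)" if "j < m" for j m e and x :: "nat \<Rightarrow> 'a"
  proof -
    have "(\<Sum>i<m. emb (if i = j then 1 else if i < j then e i else 0) * x i)
        = (\<Sum>i\<in>insert j {..<j}. emb (if i = j then 1 else if i < j then e i else 0) * x i)"
      using that by (intro sum.mono_neutral_right) auto
    also have "\<dots> = x j + (\<Sum>i<j. emb (e i) * x i)"
      by (simp add: sum.insert)
    finally show ?thesis .
  qed
  have B: "B \<in> carrier_mat r r" "upper_triangular B" and A: "A \<in> carrier_mat s s" "upper_triangular A"
    and C: "C \<in> carrier_mat r s"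
    by (auto simp: A_def B_def C_def)
  have "u = (map_mat emb B)\<^sup>T *\<^sub>v u'"
  proof (rule eq_vecI)
    fix j assume "j < dim_vec ((map_mat emb B)\<^sup>T *\<^sub>v u')"
    then have j: "j < r" using B by simp
    have "((map_mat emb B)\<^sup>T *\<^sub>v u') $ j
        = (\<Sum>i<r. emb (if i = j then 1 else if i < j then d j i else 0) * g i)"
      using j by (simp add: B_def u'_def scalar_prod_def atLeast0LessThan)
    also have "\<dots> = g j + (\<Sum>i<j. emb (d j i) * g i)"
      using j by (rule triangular_sum)
    also have "(\<Sum>i<j. emb (d j i) * g i) = (\<Sum>i<j. emb (d j i) * h i)"
      using j by (intro sum.cong) (auto simp: h_def)
    also have "g j + \<dots> = u $ j" using d[of j] fu[OF j] by simp
    finally show "u $ j = ((map_mat emb B)\<^sup>T *\<^sub>v u') $ j" by simp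
  qed (use u B in simp)
  moreover have "(map_mat emb A)\<^sup>T *\<^sub>v p + (map_mat emb C)\<^sup>T *\<^sub>v u' = p'"
  proof (rule eq_vecI)
    fix j assume "j < dim_vec p'"
    then have j: "j < s" by (simp add: p'_def)
    have "((map_mat emb A)\<^sup>T *\<^sub>v p) $ j
        = (\<Sum>i<s. emb (if i = j then 1 else if i < j then - d (r + j) (r + i) else 0) * p $ i)"
      using j p by (simp add: A_def scalar_prod_def atLeast0LessThan)
    also have "\<dots> = p $ j + (\<Sum>i<j. emb (- d (r + j) (r + i)) * p $ i)"
      using j by (rule triangular_sum)
    also have "\<dots> = p $ j - (\<Sum>i<j. emb (d (r + j) (r + i)) * h (r + i))"
      using j by (simp add: hom_uminus sum_negf h_def fp)
    finally have 1: "((map_mat emb A)\<^sup>T *\<^sub>v p) $ j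
        = p $ j - (\<Sum>i<j. emb (d (r + j) (r + i)) * h (r + i))" .
    have "((map_mat emb C)\<^sup>T *\<^sub>v u') $ j = (\<Sum>i<r. emb (- d (r + j) i) * g i)"
      using j by (simp add: C_def u'_def scalar_prod_def atLeast0LessThan)
    also have "\<dots> = - (\<Sum>i<r. emb (d (r + j) i) * h i)"
      by (simp add: hom_uminus sum_negf h_def)
    finally have 2: "((map_mat emb C)\<^sup>T *\<^sub>v u') $ j = - (\<Sum>i<r. emb (d (r + j) i) * h i)" .
    \<comment> \<open>The sum over the positions before \<open>r + j\<close> is cut at
      \<open>r\<close>: the first piece is cancelled by \<open>C\<close>, the second by
      \<open>A\<close>.\<close>
    have "p $ j = g (r + j) + (\<Sum>i<r. emb (d (r + j) i) * h i)
        + (\<Sum>i<j. emb (d (r + j) (r + i)) * h (r + i))"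
      using d[of "r + j"] fp[OF j] by (simp add: sum_lessThan_add add.assoc)
    then show "((map_mat emb A)\<^sup>T *\<^sub>v p + (map_mat emb C)\<^sup>T *\<^sub>v u') $ j = p' $ j"
      using j C 1 2 by (simp add: p'_def)
  qed (use C in \<open>simp add: p'_def\<close>)
  moreover have "hamming_weight u' + hamming_weight p' \<le> rank_weight emb bs (u @\<^sub>v p)"
  proof -
    \<comment> \<open>Together the two reduced vectors are \<open>g\<close> on \<open>r + s\<close>
      positions, and \<open>g\<close> vanishes off the pivots, whose number is at most the
      rank.\<close>
    have "u' @\<^sub>v p' = vec (r + s) g"
      by (intro eq_vecI) (auto simp: u'_def p'_def)
    then have "hamming_weight u' + hamming_weight p' = card {j. j < r + s \<and> g j \<noteq> 0}"
      unfolding hamming_weight_append[symmetric]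
      by (simp add: hamming_weight_def conj_commute cong: conj_cong)
    also have "\<dots> \<le> card {j. j < r + s \<and> new_index f j}"
      by (intro card_mono) (auto simp: g_def reduced_def)
    also have "\<dots> \<le> rank_weight emb bs (u @\<^sub>v p)"
      using card_new_indices_le[of "u @\<^sub>v p"] u p by (simp add: f_def)
    finally show ?thesis .
  qed
  moreover have "invertible_mat B" "invertible_mat A"
    using A B by (auto intro!: invertible_unitriangular simp: A_def B_def)
  ultimately show ?thesis
    using that[of B C A u'] A B C by (simp add: u'_def)
qed

section \<open>The MSRD property in terms of messages\<close>

text \<open>The weight \<open>n - k + 1\<close> is not exceeded by the first row of the encoder, so the minimum
  need only be bounded from below.\<close>

lemma MSRD_systematic_iff:
  assumes P: "\<And>i. i < l \<Longrightarrow> P i \<in> carrier_mat k (ns i - ks i)"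
    and le: "\<And>i. i < l \<Longrightarrow> ks i \<le> ns i"
    and k: "k = part_offset ks l" "1 \<le> k"
  shows "MSRD emb bs l ns (code_of (systematic_encoder k l ks P)) \<longleftrightarrow>
    (\<forall>u\<in>carrier_vec k. u \<noteq> 0\<^sub>v k \<longrightarrow> part_offset ns l - k <
       (\<Sum>i<l. rank_weight emb bs (vec_part ks u i @\<^sub>v ((P i)\<^sup>T *\<^sub>v u))))"
proof -
  define G where "G = systematic_encoder k l ks P"
  define n where "n = part_offset ns l"
  define wt where "wt u = (\<Sum>i<l. rank_weight emb bs (vec_part ks u i @\<^sub>v ((P i)\<^sup>T *\<^sub>v u)))" for u
  have G: "G \<in> carrier_mat k n"
    unfolding G_def n_def using P le by (rule systematic_encoder_carrier)
  have part: "vec_part ns (G\<^sup>T *\<^sub>v u) i = vec_part ks u i @\<^sub>v ((P i)\<^sup>T *\<^sub>v u)"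
    if "u \<in> carrier_vec k" "i < l" for u i
    unfolding G_def using P le k(1) that by (rule vec_part_systematic_encoder)
  \<comment> \<open>The first \<open>ks i\<close> entries of the \<open>i\<close>-th part of a
    codeword display that part of \<open>u\<close>.\<close>
  have inj: "u = 0\<^sub>v k" if u: "u \<in> carrier_vec k" and "G\<^sup>T *\<^sub>v u = 0\<^sub>v n" for u
  proof -
    have parts: "vec_part ks u i = vec_part ks (0\<^sub>v k) i" if i: "i < l" for i
    proof (rule eq_vecI)
      fix a assume "a < dim_vec (vec_part ks (0\<^sub>v k :: 'a vec) i)"
      then have a: "a < ks i" by simp
      have "vec_part ks u i $ a = vec_part ns (G\<^sup>T *\<^sub>v u) i $ a"
        unfolding part[OF u i] using a by simp
      also have "\<dots> = 0"
        using a le[OF i] part_offset_add_less[where ns = ns, OF i, of a]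
        by (simp add: \<open>G\<^sup>T *\<^sub>v u = 0\<^sub>v n\<close> n_def)
      finally show "vec_part ks u i $ a = vec_part ks (0\<^sub>v k) i $ a"
        using a part_offset_add_less[where ns = ks, OF i, of a] k(1) by simp
    qed simp
    show ?thesis
      by (rule vec_parts_eqI[of u ks l]) (use u parts in \<open>simp_all add: k(1)\<close>)
  qed
  have nz: "G\<^sup>T *\<^sub>v u \<noteq> 0\<^sub>v n \<longleftrightarrow> u \<noteq> 0\<^sub>v k" if "u \<in> carrier_vec k" for u
    using inj[OF that] G by auto
  have dist: "sum_rank_dist emb bs l ns (G\<^sup>T *\<^sub>v u) (0\<^sub>v n) = wt u" if "u \<in> carrier_vec k" for u
    unfolding sum_rank_dist_def wt_def
  proof (rule sum.cong)
    fix i assume "i \<in> {..<l}"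
    then have i: "i < l" by simp
    have "vec_part ns (G\<^sup>T *\<^sub>v u) i - vec_part ns (0\<^sub>v n) i = vec_part ns (G\<^sup>T *\<^sub>v u) i"
      unfolding n_def vec_part_0[OF i] by (rule minus_zero_vec) simp
    then show "rank_weight emb bs (vec_part ns (G\<^sup>T *\<^sub>v u) i - vec_part ns (0\<^sub>v n) i)
        = rank_weight emb bs (vec_part ks u i @\<^sub>v ((P i)\<^sup>T *\<^sub>v u))"
      by (simp add: part[OF that i])
  qed simp
  define D where "D = wt ` {u \<in> carrier_vec k. u \<noteq> 0\<^sub>v k}"
  have D_eq: "{sum_rank_dist emb bs l ns v (0\<^sub>v n) | v. v \<in> code_of G \<and> v \<noteq> 0\<^sub>v n} = D"
  proof (intro equalityI subsetI)
    fix d assume "d \<in> {sum_rank_dist emb bs l ns v (0\<^sub>v n) | v. v \<in> code_of G \<and> v \<noteq> 0\<^sub>v n}"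
    then obtain u where "u \<in> carrier_vec k" "G\<^sup>T *\<^sub>v u \<noteq> 0\<^sub>v n"
      "d = sum_rank_dist emb bs l ns (G\<^sup>T *\<^sub>v u) (0\<^sub>v n)"
      using carrier_matD(1)[OF G] by (auto simp: code_of_def)
    then show "d \<in> D" using nz dist by (auto simp: D_def)
  next
    fix d assume "d \<in> D"
    then obtain u where u: "u \<in> carrier_vec k" "u \<noteq> 0\<^sub>v k" "d = wt u"
      by (auto simp: D_def)
    then have "G\<^sup>T *\<^sub>v u \<in> code_of G"
      using carrier_matD(1)[OF G] by (auto simp: code_of_def)
    with u show "d \<in> {sum_rank_dist emb bs l ns v (0\<^sub>v n) | v. v \<in> code_of G \<and> v \<noteq> 0\<^sub>v n}"
      using nz dist by (intro CollectI exI[of _ "G\<^sup>T *\<^sub>v u"]) simp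
  qed
  have dim: "dim_vec ((P i)\<^sup>T *\<^sub>v u) = ns i - ks i" if "i < l" for u i
    using P[OF that] by simp
  \<comment> \<open>Rank is at most Hamming weight, and the \<open>ns i - ks i\<close> redundant
    entries in each part contribute at most \<open>n - k\<close> in all.\<close>
  have wt_le: "wt u \<le> hamming_weight u + (n - k)" if u: "u \<in> carrier_vec k" for u
  proof -
    have "wt u \<le> (\<Sum>i<l. hamming_weight (vec_part ks u i) + (ns i - ks i))"
      unfolding wt_def
    proof (rule sum_mono)
      fix i assume "i \<in> {..<l}"
      then show "rank_weight emb bs (vec_part ks u i @\<^sub>v ((P i)\<^sup>T *\<^sub>v u))
          \<le> hamming_weight (vec_part ks u i) + (ns i - ks i)"
        using rank_weight_le_self[of "vec_part ks u i @\<^sub>v ((P i)\<^sup>T *\<^sub>v u)"]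
          hamming_weight_le_dim[of "(P i)\<^sup>T *\<^sub>v u"] dim[of i u]
        by (simp add: hamming_weight_append)
    qed
    also have "\<dots> = hamming_weight u + (\<Sum>i<l. ns i - ks i)"
      using u k(1) by (simp add: sum.distrib hamming_weight_parts)
    also have "(\<Sum>i<l. ns i - ks i) = n - k"
      using part_offset_diff[of l ks ns, OF le] by (simp add: n_def k(1) part_offset_def)
    finally show ?thesis .
  qed
  \<comment> \<open>Needed to reason about \<open>Min\<close>; \<open>wt_le\<close> bounds all
    weights by \<open>k + (n - k)\<close>.\<close>
  have "finite D"
  proof (rule finite_subset)
    show "D \<subseteq> {..k + (n - k)}"
    proof
      fix d assume "d \<in> D"
      then obtain u where u: "u \<in> carrier_vec k" "d = wt u" by (auto simp: D_def)
      show "d \<in> {..k + (n - k)}"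
        using wt_le[OF u(1)] hamming_weight_le_dim[of u] u by simp
    qed
  qed simp
  have unit: "unit_vec k 0 \<in> {u \<in> carrier_vec k. u \<noteq> (0\<^sub>v k :: 'a vec)}"
    using k(2) by (auto simp: unit_vec_nonzero)
  then have D0: "wt (unit_vec k 0) \<in> D" "wt (unit_vec k 0) \<le> n - k + 1"
    using wt_le[of "unit_vec k 0"] hamming_weight_unit_vec_le[of k 0, where 'a = 'a] by (auto simp: D_def)
  \<comment> \<open>Injectivity yields linearity and dimension \<open>k\<close>, so only the
    equation for the minimum remains.\<close>
  have "MSRD emb bs l ns (code_of G) \<longleftrightarrow> Min D = n - k + 1"
    using code_of_injective[OF G inj] D_eq
    by (simp add: MSRD_def min_sum_rank_dist_def Let_def n_def part_offset_def)
  also have "\<dots> \<longleftrightarrow> (\<forall>d\<in>D. n - k < d)"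
  proof
    assume "Min D = n - k + 1"
    then have "n - k + 1 \<le> d" if "d \<in> D" for d
      using Min_le[OF \<open>finite D\<close> that] by simp
    then show "\<forall>d\<in>D. n - k < d" by (simp add: Suc_le_eq)
  next
    assume less: "\<forall>d\<in>D. n - k < d"
    with D0 have "wt (unit_vec k 0) = n - k + 1" by (simp add: le_antisym Suc_le_eq)
    with D0(1) have "n - k + 1 \<in> D" by simp
    then show "Min D = n - k + 1"
      using \<open>finite D\<close> less by (intro Min_eqI) (auto simp: Suc_le_eq)
  qed
  finally show ?thesis
    unfolding D_def G_def[symmetric] n_def[symmetric] by (auto simp: wt_def)
qed

end

section \<open>Equivalence of the MSRD property and superregularity, assembled from the
  blocks\<close>

theorem theorem5:
  fixes emb :: "'f::{field,finite} \<Rightarrow> 'a::{field,finite}"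
    and bs :: "'a list"
    and q M l k n :: nat
    and ns ks :: "nat \<Rightarrow> nat"
    and P :: "nat \<Rightarrow> 'a mat"
  assumes "primepow q" and "M \<ge> 1"
    and "CARD('f) = q" and "CARD('a) = q ^ M"
    and "field_hom emb" and "ext_basis emb bs"
    and "l \<ge> 1" and "1 \<le> k" and "k < n"
    and "n = (\<Sum>i<l. ns i)" and "\<And>i. i < l \<Longrightarrow> 1 \<le> ns i"
    and "k = (\<Sum>i<l. ks i)" and "\<And>i. i < l \<Longrightarrow> ks i \<le> ns i"
    and "\<And>i. i < l \<Longrightarrow> P i \<in> carrier_mat k (ns i - ks i)"
  shows "MSRD emb bs l ns (code_of (systematic_encoder k l ks P)) \<longleftrightarrow>
    (\<forall>(C :: nat \<Rightarrow> 'f mat) (B :: nat \<Rightarrow> 'f mat) (A :: nat \<Rightarrow> 'f mat).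
       (\<forall>i<l. C i \<in> carrier_mat (ks i) (ns i - ks i)
          \<and> B i \<in> carrier_mat (ks i) (ks i) \<and> invertible_mat (B i) \<and> upper_triangular (B i)
          \<and> A i \<in> carrier_mat (ns i - ks i) (ns i - ks i) \<and> invertible_mat (A i)
          \<and> upper_triangular (A i)) \<longrightarrow>
       full_superregular
         (map_mat emb (block_diag l B) * hconcat_mat k (map P [0..<l]) * map_mat emb (block_diag l A)
           + map_mat emb (block_diag l C)))"
proof -
  interpret field_hom emb by fact
  interpret ext_field emb bs by unfold_locales fact
  note le = assms(13) and P = assms(14)
  have n: "n = part_offset ns l" and k: "k = part_offset ks l"
    using assms(10,12) by (simp_all add: part_offset_def)
  define ms where "ms = (\<lambda>i. ns i - ks i)"
  have m: "part_offset ms l = n - k"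
    unfolding ms_def n k using le by (rule part_offset_diff)
  let ?adm = "\<lambda>C B A. \<forall>i<l. C i \<in> carrier_mat (ks i) (ns i - ks i)
          \<and> B i \<in> carrier_mat (ks i) (ks i) \<and> invertible_mat (B i) \<and> upper_triangular (B i)
          \<and> A i \<in> carrier_mat (ns i - ks i) (ns i - ks i) \<and> invertible_mat (A i)
          \<and> upper_triangular (A i)"
  define P' where "P' = hconcat_mat k (map P [0..<l])"
  define X where "X C B A = map_mat emb (block_diag l B) * P' * map_mat emb (block_diag l A)
           + map_mat emb (block_diag l C)" for C B A :: "nat \<Rightarrow> 'f mat"
  have P': "P' \<in> carrier_mat k (part_offset ms l)"
    unfolding P'_def using P by (intro hconcat_mat_carrier) (simp add: ms_def)
  \<comment> \<open>The relation \<open>w = u B\<close> is expressed by parts because it is used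
    both ways: once \<open>w\<close> is computed from \<open>u\<close>, and once \<open>w\<close> is
    the given message and \<open>u\<close> is glued from its reduced parts.\<close>
  have X_carrier: "X C B A \<in> carrier_mat k (n - k)"
    and X_part: "\<And>u w i. u \<in> carrier_vec k \<Longrightarrow> w \<in> carrier_vec k \<Longrightarrow>
        (\<And>i. i < l \<Longrightarrow> vec_part ks w i = (map_mat emb (B i))\<^sup>T *\<^sub>v vec_part ks u i) \<Longrightarrow> i < l \<Longrightarrow>
        vec_part ms ((X C B A)\<^sup>T *\<^sub>v u) i
          = (map_mat emb (A i))\<^sup>T *\<^sub>v ((P i)\<^sup>T *\<^sub>v w) + (map_mat emb (C i))\<^sup>T *\<^sub>v vec_part ks u i"
    and X_obtain: "\<And>u. u \<in> carrier_vec k \<Longrightarrow> \<exists>w\<in>carrier_vec k.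
        \<forall>i<l. vec_part ks w i = (map_mat emb (B i))\<^sup>T *\<^sub>v vec_part ks u i"
    if adm: "?adm C B A" for C B A
  proof -
    let ?e = "\<lambda>Y i. map_mat emb (Y i)"
    have car: "\<And>i. i < l \<Longrightarrow> ?e B i \<in> carrier_mat (ks i) (ks i)"
      "\<And>i. i < l \<Longrightarrow> ?e A i \<in> carrier_mat (ms i) (ms i)"
      "\<And>i. i < l \<Longrightarrow> ?e C i \<in> carrier_mat (ks i) (ms i)"
      using adm by (simp_all add: ms_def)
    define Bd Ad Cd where "Bd = block_diag l (?e B)" and "Ad = block_diag l (?e A)"
      and "Cd = block_diag l (?e C)"
    have "map_mat emb (block_diag l B) = Bd" "map_mat emb (block_diag l A) = Ad"
      "map_mat emb (block_diag l C) = Cd"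
      unfolding Bd_def Ad_def Cd_def
      using adm by (auto intro!: map_mat_block_diag)
    then have X: "X C B A = Bd * P' * Ad + Cd" by (simp add: X_def)
    have dcar: "Bd \<in> carrier_mat k k" "Ad \<in> carrier_mat (part_offset ms l) (part_offset ms l)"
      "Cd \<in> carrier_mat k (part_offset ms l)"
      unfolding Bd_def Ad_def Cd_def k using car by (auto intro: block_diag_carrier)
    show "X C B A \<in> carrier_mat k (n - k)"
      unfolding X m[symmetric] using dcar P' by simp
    have Bd_part: "vec_part ks (Bd\<^sup>T *\<^sub>v u) i = (?e B i)\<^sup>T *\<^sub>v vec_part ks u i"
      if "u \<in> carrier_vec k" "i < l" for u i
      unfolding Bd_def using car(1) that(1)[unfolded k] that(2) by (rule vec_part_block_diag_mult)
    show "\<exists>w\<in>carrier_vec k. \<forall>i<l. vec_part ks w i = (map_mat emb (B i))\<^sup>T *\<^sub>v vec_part ks u i"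
      if "u \<in> carrier_vec k" for u
      using Bd_part[OF that] dcar(1) that by (intro bexI[of _ "Bd\<^sup>T *\<^sub>v u"]) auto
    show "vec_part ms ((X C B A)\<^sup>T *\<^sub>v u) i
          = (map_mat emb (A i))\<^sup>T *\<^sub>v ((P i)\<^sup>T *\<^sub>v w) + (map_mat emb (C i))\<^sup>T *\<^sub>v vec_part ks u i"
      if u: "u \<in> carrier_vec k" and w: "w \<in> carrier_vec k"
        and parts: "\<And>i. i < l \<Longrightarrow> vec_part ks w i = (map_mat emb (B i))\<^sup>T *\<^sub>v vec_part ks u i"
        and i: "i < l" for u w i
    proof -
      \<comment> \<open>Only the parts of \<open>w\<close> are prescribed, but they determine the
        whole vector.\<close>
      have "Bd\<^sup>T *\<^sub>v u = w"
        by (rule vec_parts_eqI[of _ ks l]) (use u w dcar(1) k parts Bd_part in auto)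
      then have "(X C B A)\<^sup>T *\<^sub>v u = Ad\<^sup>T *\<^sub>v (P'\<^sup>T *\<^sub>v w) + Cd\<^sup>T *\<^sub>v u"
        unfolding X using transpose_mult_add_vec[OF dcar(1) P' dcar(2,3) u] by simp
      moreover have "vec_part ms (P'\<^sup>T *\<^sub>v w) i = (P i)\<^sup>T *\<^sub>v w"
        unfolding P'_def using P i w by (intro vec_part_hconcat_mult) (simp_all add: ms_def)
      moreover have Pw: "P'\<^sup>T *\<^sub>v w \<in> carrier_vec (part_offset ms l)"
        using P' w by simp
      ultimately show ?thesis
        using vec_part_block_diag_mult[of l "?e A" ms ms "P'\<^sup>T *\<^sub>v w" i, OF car(2) Pw]
          vec_part_block_diag_mult[of l "?e C" ks ms u i, OF car(3)] i u P' dcar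
        by (simp add: vec_part_add[OF i] Ad_def Cd_def k)
    qed
  qed
  have "MSRD emb bs l ns (code_of (systematic_encoder k l ks P)) \<longleftrightarrow>
    (\<forall>u\<in>carrier_vec k. u \<noteq> 0\<^sub>v k \<longrightarrow> n - k <
       (\<Sum>i<l. rank_weight emb bs (vec_part ks u i @\<^sub>v ((P i)\<^sup>T *\<^sub>v u))))" (is "_ \<longleftrightarrow> ?W")
    unfolding n using P le k assms(8) by (rule MSRD_systematic_iff)
  also have "\<dots> \<longleftrightarrow> (\<forall>C B A. ?adm C B A \<longrightarrow> full_superregular (X C B A))"
  proof (intro iffI allI impI)
    fix C B A :: "nat \<Rightarrow> 'f mat"
    assume W: ?W and adm: "?adm C B A"
    have X: "dim_row (X C B A) = k" "dim_col (X C B A) = n - k"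
      using X_carrier[OF adm] by auto
    show "full_superregular (X C B A)"
      unfolding full_superregular_iff_weight X
    proof (intro ballI impI)
      fix u :: "'a vec" assume u: "u \<in> carrier_vec k" "u \<noteq> 0\<^sub>v k"
      obtain w where w: "w \<in> carrier_vec k"
        "\<And>i. i < l \<Longrightarrow> vec_part ks w i = (map_mat emb (B i))\<^sup>T *\<^sub>v vec_part ks u i"
        using X_obtain[OF adm u(1)] by blast
      define y where "y = (X C B A)\<^sup>T *\<^sub>v u"
      have y: "y \<in> carrier_vec (part_offset ms l)"
        unfolding y_def m by (rule carrier_vecI) (simp add: X)
      \<comment> \<open>Each \<open>B i\<close> is invertible, so if all parts of \<open>w\<close>
        vanished, so would those of \<open>u\<close>.\<close>
      have "w \<noteq> 0\<^sub>v k"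
      proof
        assume "w = 0\<^sub>v k"
        have "vec_part ks u i = 0\<^sub>v (ks i)" if i: "i < l" for i
        proof -
          have Bi: "B i \<in> carrier_mat (ks i) (ks i)" "invertible_mat (B i)" using adm i by auto
          obtain B' where B': "B' \<in> carrier_mat (ks i) (ks i)" "B i * B' = 1\<^sub>m (ks i)"
            by (rule invertible_mat_obtain[OF Bi])
          have "vec_part ks u i = (map_mat emb B')\<^sup>T *\<^sub>v ((map_mat emb (B i))\<^sup>T *\<^sub>v vec_part ks u i)"
            by (rule map_mat_inverse_transpose[OF Bi(1) B' vec_part_carrier[of ks u i], symmetric])
          also have "(map_mat emb (B i))\<^sup>T *\<^sub>v vec_part ks u i = 0\<^sub>v (ks i)"
            using w(2)[OF i, symmetric] \<open>w = 0\<^sub>v k\<close> by (simp add: k vec_part_0[OF i])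
          also have "(map_mat emb B')\<^sup>T *\<^sub>v 0\<^sub>v (ks i) = 0\<^sub>v (ks i)"
            using B' by (intro eq_vecI) auto
          finally show ?thesis .
        qed
        then have "u = 0\<^sub>v k"
          by (rule vec_parts_eq_0[of u ks l, folded k, OF u(1)])
        with u(2) show False ..
      qed
      then have "n - k < (\<Sum>i<l. rank_weight emb bs (vec_part ks w i @\<^sub>v ((P i)\<^sup>T *\<^sub>v w)))"
        using W w(1) by blast
      also have "\<dots> \<le> (\<Sum>i<l. hamming_weight (vec_part ks u i) + hamming_weight (vec_part ms y i))"
      proof (rule sum_mono)
        fix i assume "i \<in> {..<l}"
        then have i: "i < l" by simp
        have part: "vec_part ms y i = (map_mat emb (A i))\<^sup>T *\<^sub>v ((P i)\<^sup>T *\<^sub>v w)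
            + (map_mat emb (C i))\<^sup>T *\<^sub>v vec_part ks u i"
          unfolding y_def by (rule X_part[OF adm u(1) w(1) _ i]) (rule w(2))
        show "rank_weight emb bs (vec_part ks w i @\<^sub>v ((P i)\<^sup>T *\<^sub>v w))
            \<le> hamming_weight (vec_part ks u i) + hamming_weight (vec_part ms y i)"
          unfolding part w(2)[OF i]
          using adm i P[OF i] w(1)
          by (intro rank_weight_block_transform_le[where r = "ks i" and s = "ns i - ks i"]) auto
      qed
      also have "\<dots> = hamming_weight u + hamming_weight y"
        using hamming_weight_parts[OF u(1)[unfolded k]] hamming_weight_parts[OF y]
        by (simp only: sum.distrib)
      finally show "n - k < hamming_weight u + hamming_weight ((X C B A)\<^sup>T *\<^sub>v u)"
        unfolding y_def .
    qed
  next
    \<comment> \<open>For the converse the matrices may depend on \<open>u\<close>: the elimination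
      in each block chooses \<open>B i\<close>, \<open>C i\<close>, \<open>A i\<close> for this
      particular message, and superregularity is then applied to this one choice.\<close>
    assume sr: "\<forall>C B A. ?adm C B A \<longrightarrow> full_superregular (X C B A)"
    show ?W
    proof (intro ballI impI)
      fix u :: "'a vec" assume u: "u \<in> carrier_vec k" "u \<noteq> 0\<^sub>v k"
      let ?Q = "\<lambda>i B C A u'. B \<in> carrier_mat (ks i) (ks i) \<and> upper_triangular B \<and> invertible_mat B
        \<and> C \<in> carrier_mat (ks i) (ns i - ks i)
        \<and> A \<in> carrier_mat (ns i - ks i) (ns i - ks i) \<and> upper_triangular A \<and> invertible_mat A
        \<and> u' \<in> carrier_vec (ks i) \<and> vec_part ks u i = (map_mat emb B)\<^sup>T *\<^sub>v u'
        \<and> hamming_weight u' + hamming_weight ((map_mat emb A)\<^sup>T *\<^sub>v ((P i)\<^sup>T *\<^sub>v u) + (map_mat emb C)\<^sup>T *\<^sub>v u')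
          \<le> rank_weight emb bs (vec_part ks u i @\<^sub>v ((P i)\<^sup>T *\<^sub>v u))"
      have "\<exists>B C A u'. ?Q i B C A u'" if i: "i < l" for i
      proof -
        have "(P i)\<^sup>T *\<^sub>v u \<in> carrier_vec (ns i - ks i)"
          using P[OF i] u(1) by simp
        then show ?thesis
          by (rule block_elimination[OF vec_part_carrier[of ks u i]]) blast
      qed
      then obtain B C A f where Q: "\<And>i. i < l \<Longrightarrow> ?Q i (B i) (C i) (A i) (f i)"
        by metis
      have adm: "?adm C B A" using Q by blast
      obtain u' where u': "u' \<in> carrier_vec k" "\<And>i. i < l \<Longrightarrow> vec_part ks u' i = f i"
        using vec_parts_obtain[of l f ks] Q k by metis
      define y where "y = (X C B A)\<^sup>T *\<^sub>v u'"
      have X: "dim_row (X C B A) = k" "dim_col (X C B A) = n - k"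
        using X_carrier[OF adm] by auto
      have y: "y \<in> carrier_vec (part_offset ms l)"
        unfolding y_def m by (rule carrier_vecI) (simp add: X)
      have parts: "vec_part ks u i = (map_mat emb (B i))\<^sup>T *\<^sub>v vec_part ks u' i" if "i < l" for i
        using Q[OF that] u'(2)[OF that] by simp
      \<comment> \<open>Each part of \<open>u\<close> is the image of the corresponding part of
        \<open>u'\<close>, so \<open>u' = 0\<close> would force \<open>u = 0\<close>.\<close>
      have "u' \<noteq> 0\<^sub>v k"
      proof
        assume "u' = 0\<^sub>v k"
        have "vec_part ks u i = 0\<^sub>v (ks i)" if i: "i < l" for i
        proof -
          have "f i = 0\<^sub>v (ks i)"
            using u'(2)[OF i, symmetric] \<open>u' = 0\<^sub>v k\<close> by (simp add: k vec_part_0[OF i])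
          then show ?thesis
            using Q[OF i] by (intro eq_vecI) auto
        qed
        then have "u = 0\<^sub>v k"
          by (rule vec_parts_eq_0[of u ks l, folded k, OF u(1)])
        with u(2) show False ..
      qed
      moreover have "full_superregular (X C B A)"
        using sr adm by blast
      ultimately have "n - k < hamming_weight u' + hamming_weight y"
        using u'(1) unfolding full_superregular_iff_weight X y_def by blast
      also have "\<dots> = (\<Sum>i<l. hamming_weight (vec_part ks u' i) + hamming_weight (vec_part ms y i))"
        using hamming_weight_parts[OF u'(1)[unfolded k]] hamming_weight_parts[OF y]
        by (simp only: sum.distrib)
      also have "\<dots> \<le> (\<Sum>i<l. rank_weight emb bs (vec_part ks u i @\<^sub>v ((P i)\<^sup>T *\<^sub>v u)))"
      proof (rule sum_mono)
        fix i assume "i \<in> {..<l}"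
        then have i: "i < l" by simp
        have part: "vec_part ms y i = (map_mat emb (A i))\<^sup>T *\<^sub>v ((P i)\<^sup>T *\<^sub>v u)
            + (map_mat emb (C i))\<^sup>T *\<^sub>v vec_part ks u' i"
          \<comment> \<open>Here \<open>u'\<close> is the vector multiplied by the matrix and the
            given \<open>u\<close> is its image under the blocks \<open>B i\<close>.\<close>
          unfolding y_def by (rule X_part[OF adm u'(1) u(1) _ i]) (rule parts)
        show "hamming_weight (vec_part ks u' i) + hamming_weight (vec_part ms y i)
            \<le> rank_weight emb bs (vec_part ks u i @\<^sub>v ((P i)\<^sup>T *\<^sub>v u))"
          unfolding part u'(2)[OF i] using Q[OF i] by blast
      qed
      finally show "n - k < (\<Sum>i<l. rank_weight emb bs (vec_part ks u i @\<^sub>v ((P i)\<^sup>T *\<^sub>v u)))" .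
    qed
  qed
  finally show ?thesis unfolding X_def P'_def .
qed

end
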